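(* Let $\mathrm{TQ}$ be the multiplicative group of theta quotients and $\mathbb Z[\mathbb Z_{>0}]$ the free abelian group on the positive integers. The map $f\mapsto\operatorname{Div}(f)$ is a group homomorphism giving an exact sequence $$1\to\eta^{\mathbb Z}\to\mathrm{TQ}\xrightarrow{\operatorname{Div}}\mathbb Z[\mathbb Z_{>0}]\to 1,$$ and this sequence splits via the map $D=\sum_a n_a(a)\mapsto S_D:=\prod_a S_a^{n_a}$.
   Context: Let $\eta(\tau)=q^{1/24}\prod_{n\ge1}(1-q^n)$, $\vartheta(\tau,z)=\sum_{r\in\mathbb Z}\left(\frac{-4}{r}\right)q^{r^2/8}\zeta^{r/2}$ with $q=e^{2\pi i\tau}$, $\zeta=e^{2\pi i z}$, $\tau\in\mathbb H$, $z\in\mathbb C$, and $\vartheta_a(\tau,z)=\vartheta(\tau,az)$. A theta quotient is a function of the form $\eta^n\,\vartheta_{a_1}\cdots\vartheta_{a_r}/(\vartheta_{b_1}\cdots\vartheta_{b_s})$ with $n\in\mathbb Z$ and nonzero integers $a_j,b_j$; these form a group $\mathrm{TQ}$ under multiplication. For fixed $\tau$, the divisor of a theta quotient $f(\tau,\cdot)$ on $\mathbb C/(\mathbb Z\tau+\mathbb Z)$ has the form $\sum_{a\ge1}n_a\Pi_a$ with integers $n_a$, almost all zero, where $\Pi_a$ is the formal sum of the primitive $a$-division points (points of $\frac1a(\mathbb Z\tau+\mathbb Z)$ of exact order $a$ modulo $\mathbb Z\tau+\mathbb Z$); one sets $\operatorname{Div}(f)=\sum_a n_a(a)\in\mathbb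 Z[\mathbb Z_{>0}]$ (independent of $\tau$). For $a\ge1$, $S_a=\prod_{d\mid a}\vartheta_d^{\mu(a/d)}$ with $\mu$ the Möbius function. $\eta^{\mathbb Z}$ denotes the group of integral powers of $\eta$.
   Formalization: With nonzero indices of both signs, −1 = ϑ_{-1}/ϑ_1 lies in TQ with divisor 0 but is no power of η; so the sequence is proved as displayed for positive indices, and for all of TQ with kernel ±η^ℤ in place of η^ℤ, with the splitting D ↦ S_D in both cases. *)

theory Defs
  imports
    "HOL-Complex_Analysis.Complex_Analysis"
    "HOL-Algebra.Free_Abelian_Groups"
    "HOL-Computational_Algebra.Computational_Algebra"
begin

definition upper_half_plane :: "complex set"
  where "upper_half_plane = {\<tau>. Im \<tau> > 0}"

definition dedekind_eta :: "complex \<Rightarrow> complex"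
  where "dedekind_eta \<tau> =
    exp (2 * of_real pi * \<i> * \<tau> / 24) * prodinf (\<lambda>n. 1 - exp (2 * of_real pi * \<i> * \<tau>) ^ Suc n)"

text \<open>The Kronecker symbol \<open>(-4/r)\<close>, i.e. the primitive Dirichlet character modulo 4.\<close>

definition kronecker_m4 :: "int \<Rightarrow> complex"
  where "kronecker_m4 r = (if r mod 4 = 1 then 1 else if r mod 4 = 3 then -1 else 0)"

text \<open>As usual, \<open>q\<close> and \<open>\<zeta>\<close> raised to a rational power \<open>s\<close> mean
  \<open>exp (2 \<pi> i \<tau> s)\<close> and \<open>exp (2 \<pi> i z s)\<close>.\<close>

definition jacobi_theta :: "complex \<Rightarrow> complex \<Rightarrow> complex"
  where "jacobi_theta \<tau> z =
    (\<Sum>\<^sub>\<infinity>r::int. kronecker_m4 r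
        * exp (2 * of_real pi * \<i> * \<tau> * (of_int r ^ 2 / 8))
        * exp (2 * of_real pi * \<i> * z * (of_int r / 2)))"

definition theta_scaled :: "int \<Rightarrow> complex \<Rightarrow> complex \<Rightarrow> complex"
  where "theta_scaled a \<tau> z = jacobi_theta \<tau> (of_int a * z)"

text \<open>Theta quotients are meromorphic functions, so a pointwise formula determines them only away
  from a discrete set of \<open>z\<close> for each \<open>\<tau>\<close> (where HOL's \<open>x / 0 = 0\<close> may intervene). As the canonical
  representative we take the one with removable singularities in \<open>z\<close> removed and value \<open>0\<close> at
  poles; outside the upper half plane it is \<open>undefined\<close>. In this way equality of meromorphic
  functions becomes equality in HOL.\<close>

definition mero_rep :: "(complex \<Rightarrow> complex \<Rightarrow> complex) \<Rightarrow> complex \<Rightarrow> complex \<Rightarrow> complex"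
  where "mero_rep F = restrict (\<lambda>\<tau>. remove_sings (F \<tau>)) upper_half_plane"

text \<open>The theta quotients whose indices \<open>a\<^sub>j, b\<^sub>j\<close> all lie in \<open>I\<close>.\<close>

definition theta_quotients :: "int set \<Rightarrow> (complex \<Rightarrow> complex \<Rightarrow> complex) set"
  where "theta_quotients I =
    {mero_rep (\<lambda>\<tau> z. dedekind_eta \<tau> powi n
        * (\<Prod>a\<leftarrow>as. theta_scaled a \<tau> z) / (\<Prod>b\<leftarrow>bs. theta_scaled b \<tau> z)) | n as bs.
      set as \<subseteq> I \<and> set bs \<subseteq> I}"

definition theta_quotient_group :: "int set \<Rightarrow> (complex \<Rightarrow> complex \<Rightarrow> complex) monoid"
  where "theta_quotient_group I =
    \<lparr>carrier = theta_quotients I,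
     monoid.mult = (\<lambda>f g. mero_rep (\<lambda>\<tau> z. f \<tau> z * g \<tau> z)),
     one = mero_rep (\<lambda>\<tau> z. 1)\<rparr>"

text \<open>Since \<open>theta_scaled (-a) = - theta_scaled a\<close>, allowing indices of both signs puts the constant
  \<open>-1\<close> into the group; \<open>TQ_pos\<close> is the subgroup generated by \<open>\<eta>\<close> and the \<open>theta_scaled a\<close>
  with \<open>a > 0\<close>.\<close>

definition TQ :: "(complex \<Rightarrow> complex \<Rightarrow> complex) monoid"
  where "TQ = theta_quotient_group {a. a \<noteq> 0}"

definition TQ_pos :: "(complex \<Rightarrow> complex \<Rightarrow> complex) monoid"
  where "TQ_pos = theta_quotient_group {a. a > 0}"

definition eta_powers :: "(complex \<Rightarrow> complex \<Rightarrow> complex) set"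
  where "eta_powers = {mero_rep (\<lambda>\<tau> z. dedekind_eta \<tau> powi n) | n. True}"

definition signed_eta_powers :: "(complex \<Rightarrow> complex \<Rightarrow> complex) set"
  where "signed_eta_powers =
    {mero_rep (\<lambda>\<tau> z. \<epsilon> * dedekind_eta \<tau> powi n) | \<epsilon> n. \<epsilon> \<in> {1, -1}}"

definition period_lattice :: "complex \<Rightarrow> complex set"
  where "period_lattice \<tau> = {of_int m * \<tau> + of_int n | m n. True}"

definition primitive_division_point :: "complex \<Rightarrow> nat \<Rightarrow> complex \<Rightarrow> bool"
  where "primitive_division_point \<tau> a z \<longleftrightarrow>
    a > 0 \<and> of_nat a * z \<in> period_lattice \<tau> \<and>
    (\<forall>d. 0 < d \<and> d < a \<longrightarrow> of_nat d * z \<notin> period_lattice \<tau>)"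

text \<open>For every \<open>\<tau>\<close> the divisor of \<open>f \<tau>\<close> on the torus is the sum of \<open>n\<^sub>a \<Pi>\<^sub>a\<close>, where \<open>n\<^sub>a\<close> is
  \<open>lookup D a\<close> and \<open>\<Pi>\<^sub>a\<close> is the formal sum of the primitive \<open>a\<close>-division points. Divisors are
  compared coefficientwise, at all complex representatives \<open>z\<close> of points of the torus.\<close>

definition has_Div :: "(complex \<Rightarrow> complex \<Rightarrow> complex) \<Rightarrow> (nat \<Rightarrow>\<^sub>0 int) \<Rightarrow> bool"
  where "has_Div f D \<longleftrightarrow>
    (\<forall>\<tau>\<in>upper_half_plane. \<forall>z. zorder (f \<tau>) z =
       (\<Sum>a\<in>Poly_Mapping.keys D.
          Poly_Mapping.lookup D a * (if primitive_division_point \<tau> a z then 1 else 0)))"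

definition Div :: "(complex \<Rightarrow> complex \<Rightarrow> complex) \<Rightarrow> (nat \<Rightarrow>\<^sub>0 int)"
  where "Div f = (THE D. Poly_Mapping.keys D \<subseteq> {0<..} \<and> has_Div f D)"

definition moebius :: "nat \<Rightarrow> int"
  where "moebius n = (if squarefree n then (-1) ^ card (prime_factors n) else 0)"

definition S_prim :: "nat \<Rightarrow> complex \<Rightarrow> complex \<Rightarrow> complex"
  where "S_prim a = mero_rep (\<lambda>\<tau> z. \<Prod>d | d dvd a. theta_scaled (int d) \<tau> z powi moebius (a div d))"

definition S_Div :: "(nat \<Rightarrow>\<^sub>0 int) \<Rightarrow> complex \<Rightarrow> complex \<Rightarrow> complex"
  where "S_Div D = mero_rep
    (\<lambda>\<tau> z. \<Prod>a\<in>Poly_Mapping.keys D. S_prim a \<tau> z powi Poly_Mapping.lookup D a)"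

text \<open>The library's \<open>short_exact_sequence\<close> forces all groups to have the same element type; this is
  its characterization \<open>short_exact_sequence_iff\<close>, for different element types and with arrows in
  reading order.\<close>

definition short_exact ::
    "('a, 'm) monoid_scheme \<Rightarrow> ('b, 'n) monoid_scheme \<Rightarrow> ('c, 'k) monoid_scheme
      \<Rightarrow> ('a \<Rightarrow> 'b) \<Rightarrow> ('b \<Rightarrow> 'c) \<Rightarrow> bool"
  where "short_exact A B C f g \<longleftrightarrow>
    group A \<and> group B \<and> group C \<and> f \<in> mon A B \<and> g \<in> epi B C \<and> kernel B C g = f ` carrier A"

text \<open>A right splitting of a sequence ending in \<open>g : B \<rightarrow> C\<close>: a homomorphic section of \<open>g\<close>.\<close>

definition splits_via ::
    "('b, 'n) monoid_scheme \<Rightarrow> ('c, 'k) monoid_scheme \<Rightarrow> ('b \<Rightarrow> 'c) \<Rightarrow> ('c \<Rightarrow> 'b) \<Rightarrow> bool"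
  where "splits_via B C g s \<longleftrightarrow> s \<in> hom C B \<and> (\<forall>x\<in>carrier C. g (s x) = x)"

end

theory Submission
  imports Defs
begin

text \<open>The analytic input is that \<open>\<theta>(\<tau>, \<cdot>)\<close> has simple zeros exactly at the points of the period
  lattice. Let \<open>A(x) = \<Prod>(1 - q\<^sup>n x)\<close>. The product \<open>\<zeta>\<^bsup>1/2\<^esup> A(\<zeta>\<^bsup>-1\<^esup>) A(q \<zeta>)\<close> visibly has this
  property, and it transforms under \<open>z \<mapsto> z + 1\<close> and \<open>z \<mapsto> z + \<tau>\<close> like \<open>\<theta>\<close>, which vanishes at 0
  because it is odd. Hence the quotient is an entire elliptic function, thus constant, and the constant
  is nonzero because \<open>\<theta>\<close> has a nonzero Fourier coefficient. So the Jacobi triple product identity is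
  only needed up to an unspecified constant factor.

  It follows that the divisor of \<open>\<theta>\<^sub>a\<close> consists of all \<open>a\<close>-division points, each with multiplicity one,
  that is \<open>Div(\<theta>\<^sub>a) = \<Sum>(d)\<close> over \<open>d\<close> dividing \<open>a\<close>. On exponent vectors, \<open>Div\<close> and \<open>D \<mapsto> S\<^sub>D\<close> are
  therefore mutually inverse by Moebius inversion, and a theta quotient with trivial divisor has
  trivial exponents.\<close>

subsection \<open>The theta product\<close>

definition q_pochhammer :: "complex \<Rightarrow> complex \<Rightarrow> complex"
  where "q_pochhammer q x = prodinf (\<lambda>n. 1 - q ^ n * x)"

lemma convergent_prod_q_pochhammer:
  fixes q x :: complex
  assumes "norm q < 1"
  shows "convergent_prod (\<lambda>n. 1 - q ^ n * x)"
proof -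
  have "summable (\<lambda>n. norm q ^ n * norm x)"
    using assms by (intro summable_mult2 summable_geometric) auto
  then have "abs_convergent_prod (\<lambda>n. 1 - q ^ n * x)"
    by (intro summable_imp_abs_convergent_prod) (simp add: norm_mult norm_power)
  then show ?thesis
    by (rule abs_convergent_prod_imp_convergent_prod)
qed

text \<open>A convergent infinite product vanishes only if one of its factors does.\<close>

lemma q_pochhammer_eq_0_iff:
  assumes "norm q < 1"
  shows "q_pochhammer q x = 0 \<longleftrightarrow> (\<exists>n. q ^ n * x = 1)"
proof -
  have "(\<lambda>n. 1 - q ^ n * x) has_prod q_pochhammer q x"
    using convergent_prod_has_prod[OF convergent_prod_q_pochhammer[OF assms]]
    by (simp add: q_pochhammer_def)
  then show ?thesis
    by (subst has_prod_eq_0_iff) (auto simp: image_iff)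
qed

text \<open>Splitting off the factor at n = 0 leaves the product at q x. This recursion drives both
  the shift by \<tau> and the isolation of the simple zero at 0.\<close>

lemma q_pochhammer_rec:
  assumes "norm q < 1"
  shows "q_pochhammer q x = (1 - x) * q_pochhammer q (q * x)"
proof -
  have "(\<lambda>n. 1 - q ^ Suc n * x) has_prod q_pochhammer q (q * x)"
    using convergent_prod_has_prod[OF convergent_prod_q_pochhammer[OF assms, of "q * x"]]
    by (simp add: q_pochhammer_def mult.assoc mult.left_commute)
  from has_prod_unique[OF has_prod_Suc_imp[of "\<lambda>n. 1 - q ^ n * x", OF this]]
  show ?thesis
    by (simp add: q_pochhammer_def mult.commute)
qed

lemma holomorphic_q_pochhammer:
  assumes "norm q < 1"
  shows "q_pochhammer q holomorphic_on UNIV"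
proof (rule holomorphic_uniform_sequence)
  show "(\<lambda>x. \<Prod>k<n. 1 - q ^ k * x) holomorphic_on UNIV" for n
    by (intro holomorphic_intros)
next
  fix z :: complex
  have "uniformly_convergent_on (cball z 1) (\<lambda>N x. \<Sum>n<N. norm (1 - q ^ n * x - 1))"
  proof (rule Weierstrass_m_test')
    show "summable (\<lambda>n. norm q ^ n * (norm z + 1))"
      using assms by (intro summable_mult2 summable_geometric) auto
    fix n x assume "x \<in> cball z 1"
    then have "norm x \<le> norm z + 1"
      using norm_triangle_ineq2[of x z] by (simp add: dist_norm norm_minus_commute)
    then show "norm (norm (1 - q ^ n * x - 1)) \<le> norm q ^ n * (norm z + 1)"
      by (simp add: norm_mult norm_power mult_left_mono)
  qed
  then have "uniformly_convergent_on (cball z 1) (\<lambda>N x. \<Prod>n<N. 1 - q ^ n * x)"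
    by (intro uniformly_convergent_on_prod' continuous_intros) auto
  then obtain g where g: "uniform_limit (cball z 1) (\<lambda>N x. \<Prod>n<N. 1 - q ^ n * x) g sequentially"
    by (auto simp: uniformly_convergent_on_def)
  have "g x = q_pochhammer q x" if "x \<in> cball z 1" for x
  proof (rule LIMSEQ_unique)
    show "(\<lambda>N. \<Prod>n<N. 1 - q ^ n * x) \<longlonglongrightarrow> g x"
      using tendsto_uniform_limitI[OF g that] .
    \<comment> \<open>\<open>convergent_prod_LIMSEQ\<close> speaks of products up to and including
      N; the index shift matches them with the products below N.\<close>
    have "(\<lambda>N. \<Prod>n\<le>N. 1 - q ^ n * x) \<longlonglongrightarrow> q_pochhammer q x"
      using convergent_prod_LIMSEQ[OF convergent_prod_q_pochhammer[OF assms, of x]]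
      by (simp add: q_pochhammer_def)
    then show "(\<lambda>N. \<Prod>n<N. 1 - q ^ n * x) \<longlonglongrightarrow> q_pochhammer q x"
      by (subst filterlim_sequentially_Suc[symmetric]) (simp only: lessThan_Suc_atMost)
  qed
  then have "uniform_limit (cball z 1) (\<lambda>N x. \<Prod>n<N. 1 - q ^ n * x) (q_pochhammer q) sequentially"
    using g by (subst uniform_limit_cong'[of _ _ "\<lambda>N x. \<Prod>n<N. 1 - q ^ n * x" _ g]) auto
  then show "\<exists>d>0. cball z d \<subseteq> UNIV \<and>
      uniform_limit (cball z d) (\<lambda>N x. \<Prod>n<N. 1 - q ^ n * x) (q_pochhammer q) sequentially"
    by (intro exI[of _ 1]) auto
qed auto

lemma holomorphic_q_pochhammer_compose [holomorphic_intros]: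
  assumes "norm q < 1" "f holomorphic_on A"
  shows "(\<lambda>z. q_pochhammer q (f z)) holomorphic_on A"
  using holomorphic_on_compose_gen[OF assms(2) holomorphic_q_pochhammer[OF assms(1)]]
  by (simp add: o_def)

definition exp_2pi_i :: "complex \<Rightarrow> complex"
  where "exp_2pi_i z = exp (2 * of_real pi * \<i> * z)"

lemma exp_2pi_i_add: "exp_2pi_i (x + y) = exp_2pi_i x * exp_2pi_i y"
  by (simp add: exp_2pi_i_def ring_distribs exp_add)

lemma exp_2pi_i_0 [simp]: "exp_2pi_i 0 = 1"
  by (simp add: exp_2pi_i_def)

lemma exp_2pi_i_nonzero [simp]: "exp_2pi_i z \<noteq> 0"
  by (simp add: exp_2pi_i_def)

lemma exp_2pi_i_minus: "exp_2pi_i (- z) = 1 / exp_2pi_i z"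
  by (simp add: exp_2pi_i_def exp_minus inverse_eq_divide)

lemma exp_2pi_i_of_nat_mult: "exp_2pi_i (of_nat n * z) = exp_2pi_i z ^ n"
  by (simp add: exp_2pi_i_def exp_of_nat_mult[symmetric] mult_ac)

lemma holomorphic_exp_2pi_i [holomorphic_intros]:
  "f holomorphic_on A \<Longrightarrow> (\<lambda>z. exp_2pi_i (f z)) holomorphic_on A"
  unfolding exp_2pi_i_def by (intro holomorphic_intros)

lemma exp_2pi_i_eq_1_iff: "exp_2pi_i z = 1 \<longleftrightarrow> z \<in> \<int>"
proof
  assume "exp_2pi_i z = 1"
  then obtain n :: int where "- (2 * pi * Im z) = 0" "2 * pi * Re z = of_int (2 * n) * pi"
    unfolding exp_2pi_i_def exp_eq_1 by auto
  then have "z = of_int n"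
    by (auto simp: complex_eq_iff)
  then show "z \<in> \<int>" by auto
next
  assume "z \<in> \<int>"
  then obtain n where "z = of_int n" by (auto elim: Ints_cases)
  then show "exp_2pi_i z = 1"
    by (auto simp: exp_2pi_i_def exp_eq_1 intro!: exI[of _ n])
qed

lemma norm_exp_2pi_i_less_1: "\<tau> \<in> upper_half_plane \<Longrightarrow> norm (exp_2pi_i \<tau>) < 1"
  by (simp add: exp_2pi_i_def upper_half_plane_def)

text \<open>Since |q| < 1, no factor vanishes, hence neither does the product. This is what makes
  integral powers of \<eta> add up and leaves orders in z unaffected by them.\<close>

lemma dedekind_eta_nonzero:
  assumes "\<tau> \<in> upper_half_plane"
  shows "dedekind_eta \<tau> \<noteq> 0"
proof -
  define q where "q = exp_2pi_i \<tau>"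
  have q: "norm q < 1"
    using norm_exp_2pi_i_less_1[OF assms] by (simp add: q_def)
  have "norm (q ^ Suc n) < 1" for n
    unfolding norm_power using q by (subst power_less_one_iff) auto
  then have "1 - q ^ Suc n \<noteq> 0" for n
    by (metis eq_iff_diff_eq_0 norm_one order_less_irrefl)
  moreover have "convergent_prod (\<lambda>n. 1 - q ^ Suc n)"
    using convergent_prod_q_pochhammer[OF q, of q] by (simp add: mult.commute)
  ultimately have "prodinf (\<lambda>n. 1 - q ^ Suc n) \<noteq> 0"
    by (intro prodinf_nonzero)
  then show ?thesis
    by (simp add: dedekind_eta_def q_def exp_2pi_i_def)
qed

section \<open>Zeros and quasi-periodicity of the theta product\<close>

text \<open>This is the triple product without q^(1/8) and the factors 1 - q^n, which are constant
  in z.\<close>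

definition theta_product :: "complex \<Rightarrow> complex \<Rightarrow> complex"
  where "theta_product \<tau> z = exp (of_real pi * \<i> * z)
    * q_pochhammer (exp_2pi_i \<tau>) (exp_2pi_i (- z)) * q_pochhammer (exp_2pi_i \<tau>) (exp_2pi_i (\<tau> + z))"

lemma holomorphic_theta_product:
  assumes "\<tau> \<in> upper_half_plane"
  shows "theta_product \<tau> holomorphic_on UNIV"
  unfolding theta_product_def[abs_def]
  by (intro holomorphic_intros norm_exp_2pi_i_less_1 assms)

lemma period_lattice_iff: "z \<in> period_lattice \<tau> \<longleftrightarrow> (\<exists>m n::int. z = of_int m * \<tau> + of_int n)"
  by (auto simp: period_lattice_def)

text \<open>The zeros of the first product lie at m \<tau> + k with m >= 0, those of the second at m
  \<tau> + k with m < 0.\<close>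

lemma theta_product_eq_0_iff:
  assumes "\<tau> \<in> upper_half_plane"
  shows "theta_product \<tau> z = 0 \<longleftrightarrow> z \<in> period_lattice \<tau>"
proof -
  note q = norm_exp_2pi_i_less_1[OF assms]
  have pow: "exp_2pi_i \<tau> ^ n * exp_2pi_i x = exp_2pi_i (of_nat n * \<tau> + x)" for n x
    by (simp add: exp_2pi_i_add exp_2pi_i_of_nat_mult)
  have "theta_product \<tau> z = 0 \<longleftrightarrow> (\<exists>n. of_nat n * \<tau> + - z \<in> \<int> \<or> of_nat n * \<tau> + (\<tau> + z) \<in> \<int>)"
    unfolding theta_product_def
    by (simp only: mult_eq_0_iff q_pochhammer_eq_0_iff[OF q] pow exp_2pi_i_eq_1_iff exp_not_eq_zero) blast
  also have "\<dots> \<longleftrightarrow> z \<in> period_lattice \<tau>"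
  proof
    assume "\<exists>n. of_nat n * \<tau> + - z \<in> \<int> \<or> of_nat n * \<tau> + (\<tau> + z) \<in> \<int>"
    then obtain n k where "of_nat n * \<tau> + - z = of_int k \<or> of_nat n * \<tau> + (\<tau> + z) = of_int k"
      by (auto elim!: Ints_cases)
    then have "z = of_int (int n) * \<tau> + of_int (- k) \<or> z = of_int (- int (Suc n)) * \<tau> + of_int k"
      by (auto simp: algebra_simps)
    then show "z \<in> period_lattice \<tau>"
      unfolding period_lattice_iff by blast
  next
    assume "z \<in> period_lattice \<tau>"
    then obtain m k where z: "z = of_int m * \<tau> + of_int k"
      unfolding period_lattice_iff by blast
    \<comment> \<open>The sign of m decides which of the two products vanishes; the second starts at
      exponent 1, hence the index -m - 1.\<close>
    show "\<exists>n. of_nat n * \<tau> + - z \<in> \<int> \<or> of_nat n * \<tau> + (\<tau> + z) \<in> \<int>"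
    proof (cases "m \<ge> 0")
      case True
      then have "of_nat (nat m) * \<tau> + - z = of_int (- k)"
        by (simp add: z)
      then show ?thesis by (metis Ints_of_int)
    next
      case False
      then have "of_nat (nat (- m - 1)) * \<tau> + (\<tau> + z) = of_int k"
        by (simp add: z algebra_simps)
      then show ?thesis by (metis Ints_of_int)
    qed
  qed
  finally show ?thesis .
qed

lemma theta_product_plus_1: "theta_product \<tau> (z + 1) = - theta_product \<tau> z"
proof -
  have one: "exp_2pi_i 1 = 1"
    by (simp add: exp_2pi_i_eq_1_iff)
  have "exp_2pi_i (- (z + 1)) = exp_2pi_i (- z)" "exp_2pi_i (\<tau> + (z + 1)) = exp_2pi_i (\<tau> + z)"
    by (simp_all only: exp_2pi_i_add exp_2pi_i_minus one mult_1_right)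
  moreover have "exp (of_real pi * \<i> * (z + 1)) = - exp (of_real pi * \<i> * z)"
    by (simp add: ring_distribs exp_add exp_pi_i mult.commute)
  ultimately show ?thesis
    by (simp add: theta_product_def)
qed

text \<open>The shift by \<tau> adds one factor to the first product and removes one from the
  second. The ratio of these two factors is a monomial in q and \<zeta>.\<close>

lemma theta_product_plus_tau:
  assumes "\<tau> \<in> upper_half_plane"
  shows "theta_product \<tau> (z + \<tau>) = - exp (- of_real pi * \<i> * \<tau>) * exp_2pi_i (- z) * theta_product \<tau> z"
proof (cases "z \<in> period_lattice \<tau>")
  case True
  then obtain m n :: int where "z + \<tau> = of_int (m + 1) * \<tau> + of_int n"
    unfolding period_lattice_iff by (auto simp: algebra_simps)
  then have "z + \<tau> \<in> period_lattice \<tau>"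
    unfolding period_lattice_iff by blast
  with True show ?thesis
    by (simp add: theta_product_eq_0_iff[OF assms, THEN iffD2])
next
  case False
  define q where "q = exp_2pi_i \<tau>"
  define w where "w = exp_2pi_i z"
  define h where "h = exp (of_real pi * \<i> * z)"
  define s where "s = exp (of_real pi * \<i> * \<tau>)"
  have q: "norm q < 1"
    using norm_exp_2pi_i_less_1[OF assms] by (simp add: q_def)
  have nz: "q \<noteq> 0" "w \<noteq> 0" "s \<noteq> 0"
    by (simp_all add: q_def w_def s_def)
  \<comment> \<open>Here s is q^(1/2). The exponential prefactor contributes s and the two changed
    factors contribute -1 / (w q), together -1 / (s w).\<close>
  have ss: "q = s * s"
    unfolding q_def s_def exp_2pi_i_def exp_add[symmetric] by (simp add: algebra_simps)
  have "theta_product \<tau> z = h * q_pochhammer q (1 / w) * q_pochhammer q (q * w)"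
    by (simp add: theta_product_def q_def w_def h_def exp_2pi_i_add exp_2pi_i_minus)
  then have P: "theta_product \<tau> z = h * q_pochhammer q (1 / w) * (1 - q * w) * q_pochhammer q (q * (q * w))"
    using q_pochhammer_rec[OF q, of "q * w"] by simp
  have "theta_product \<tau> (z + \<tau>) = h * s * q_pochhammer q (1 / (w * q)) * q_pochhammer q (q * (q * w))"
    unfolding theta_product_def q_def w_def h_def s_def exp_2pi_i_add exp_2pi_i_minus
    by (simp add: ring_distribs exp_add mult_ac)
  also have "q_pochhammer q (1 / (w * q)) = (1 - 1 / (w * q)) * q_pochhammer q (1 / w)"
    using q_pochhammer_rec[OF q, of "1 / (w * q)"] nz by simp
  also have "1 - 1 / (w * q) = - ((1 - q * w) / (w * q))"
    using nz by (simp add: field_simps)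
  finally have "theta_product \<tau> (z + \<tau>) = - s / (w * q) * theta_product \<tau> z"
    unfolding P by (simp add: mult_ac)
  also have "- s / (w * q) = - (1 / s) * (1 / w)"
    using nz by (simp add: ss field_simps)
  finally show ?thesis
    by (simp add: s_def w_def exp_2pi_i_minus exp_minus inverse_eq_divide)
qed

text \<open>The recursion isolates the factor 1 - 1/\<zeta>, which has a simple zero at 0 with
  derivative 2 \<pi> i; the cofactor \<open>Q\<close> is nonzero there.\<close>

lemma theta_product_simple_zero_0:
  assumes "\<tau> \<in> upper_half_plane"
  obtains D where "D \<noteq> 0" "(theta_product \<tau> has_field_derivative D) (at 0)"
proof -
  define q where "q = exp_2pi_i \<tau>"
  have q: "norm q < 1"
    using norm_exp_2pi_i_less_1[OF assms] by (simp add: q_def)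
  define Q where "Q = (\<lambda>z. exp (of_real pi * \<i> * z) * q_pochhammer q (q * exp_2pi_i (- z))
    * q_pochhammer q (q * exp_2pi_i z))"
  have eq: "theta_product \<tau> = (\<lambda>z. (1 - exp_2pi_i (- z)) * Q z)"
  proof
    fix z
    show "theta_product \<tau> z = (1 - exp_2pi_i (- z)) * Q z"
      using q_pochhammer_rec[OF q, of "exp_2pi_i (- z)"]
      by (simp add: theta_product_def Q_def exp_2pi_i_add flip: q_def)
  qed
  have "Q holomorphic_on UNIV"
    unfolding Q_def by (intro holomorphic_intros q)
  then obtain Q' where Q': "(Q has_field_derivative Q') (at 0)"
    by (meson UNIV_I holomorphic_derivI open_UNIV)
  have "q ^ Suc n \<noteq> 1" for n
    using power_less_one_iff[of "norm q" "Suc n"] q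
    by (metis norm_ge_zero norm_one norm_power order_less_irrefl zero_less_Suc)
  then have "q_pochhammer q q \<noteq> 0"
    using q_pochhammer_eq_0_iff[OF q, of q] by (simp add: mult.commute)
  then have "Q 0 \<noteq> 0"
    by (simp add: Q_def)
  have "(theta_product \<tau> has_field_derivative (2 * of_real pi * \<i> * Q 0)) (at 0)"
    unfolding eq exp_2pi_i_def by (rule derivative_eq_intros Q' refl | simp)+
  with \<open>Q 0 \<noteq> 0\<close> show ?thesis
    by (intro that[of "2 * of_real pi * \<i> * Q 0"]) auto
qed

subsection \<open>The theta series and its zeros\<close>

definition theta_term :: "complex \<Rightarrow> int \<Rightarrow> complex \<Rightarrow> complex"
  where "theta_term \<tau> r z = kronecker_m4 r
        * exp (2 * of_real pi * \<i> * \<tau> * (of_int r ^ 2 / 8))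
        * exp (2 * of_real pi * \<i> * z * (of_int r / 2))"

lemma jacobi_theta_altdef: "jacobi_theta \<tau> z = (\<Sum>\<^sub>\<infinity>r. theta_term \<tau> r z)"
  by (simp add: jacobi_theta_def theta_term_def)

lemma summable_on_power_nat_abs:
  fixes x :: real
  assumes "0 \<le> x" "x < 1"
  shows "(\<lambda>r::int. x ^ nat \<bar>r\<bar>) summable_on UNIV"
proof -
  have *: "(\<lambda>n. x ^ n) summable_on UNIV"
    using assms by (subst summable_on_UNIV_nonneg_real_iff) (auto intro: summable_geometric)
  have "(\<lambda>r::int. x ^ nat \<bar>r\<bar>) summable_on range int"
    using * by (subst summable_on_reindex) (auto simp: o_def)
  moreover have "(\<lambda>r::int. x ^ nat \<bar>r\<bar>) summable_on range (\<lambda>n. - int n)"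
    using * by (subst summable_on_reindex) (auto simp: o_def inj_on_def)
  ultimately have "(\<lambda>r::int. x ^ nat \<bar>r\<bar>) summable_on (range int \<union> range (\<lambda>n. - int n))"
    by (rule summable_on_union)
  moreover have "range int \<union> range (\<lambda>n. - int n) = UNIV"
    by (auto simp: image_iff) (metis int_cases2)
  ultimately show ?thesis by simp
qed

text \<open>On a horizontal strip the Gaussian decay in r beats the exponential growth coming from
  z. The resulting majorant serves for holomorphy and for termwise integration.\<close>

lemma theta_term_bound:
  assumes "\<tau> \<in> upper_half_plane"
  obtains M where "M summable_on UNIV"
    and "\<And>r z. \<bar>Im z\<bar> \<le> R \<Longrightarrow> norm (theta_term \<tau> r z) \<le> M r"
proof -
  define y where "y = Im \<tau>"
  have y: "y > 0"
    using assms by (simp add: upper_half_plane_def y_def)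
  \<comment> \<open>The 1 in \<open>b\<close> leaves a spare factor exp (-t) with t = |r|, and
    \<open>C\<close> is the constant produced by completing the square in b t - \<pi> y t^2 /
    4.\<close>
  define b where "b = pi * R + 1"
  define C where "C = b\<^sup>2 / (pi * y)"
  define M where "M = (\<lambda>r::int. exp C * exp (- 1) ^ nat \<bar>r\<bar>)"
  have "M summable_on UNIV"
    unfolding M_def by (intro summable_on_cmult_right summable_on_power_nat_abs) auto
  moreover have "norm (theta_term \<tau> r z) \<le> M r" if z: "\<bar>Im z\<bar> \<le> R" for r z
  proof -
    define t where "t = real_of_int \<bar>r\<bar>"
    have t: "t \<ge> 0" "(real_of_int r)\<^sup>2 = t\<^sup>2"
      by (auto simp: t_def)
    have "norm (theta_term \<tau> r z) \<le> exp (- (pi * y * t\<^sup>2 / 4)) * exp (- (pi * Im z * of_int r))"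
      using t by (simp add: theta_term_def norm_mult kronecker_m4_def y_def field_simps power2_eq_square)
    also have "\<dots> \<le> exp (- (pi * y * t\<^sup>2 / 4)) * exp (pi * R * t)"
    proof -
      have "- (Im z * of_int r) \<le> \<bar>Im z\<bar> * t"
        unfolding t_def of_int_abs abs_mult[symmetric] by linarith
      also have "\<dots> \<le> R * t"
        using z t by (intro mult_right_mono) auto
      finally have "pi * (- (Im z * of_int r)) \<le> pi * (R * t)"
        by (intro mult_left_mono) auto
      then show ?thesis
        by (simp add: mult.assoc)
    qed
    also have "\<dots> = exp (pi * R * t - pi * y * t\<^sup>2 / 4)"
      by (simp add: exp_add[symmetric])
    also have "\<dots> \<le> exp (C - t)"
    proof -
      have "0 \<le> (pi * y * t / 2 - b)\<^sup>2 / (pi * y)"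
        using y by (intro divide_nonneg_pos) auto
      also have "\<dots> = pi * y * t\<^sup>2 / 4 - b * t + C"
        using y by (simp add: C_def power2_eq_square field_simps)
      finally show ?thesis
        by (simp add: b_def ring_distribs)
    qed
    also have "\<dots> = M r"
    proof -
      have "exp (- 1 :: real) ^ nat \<bar>r\<bar> = exp (- t)"
        by (simp add: exp_of_nat_mult[symmetric] t_def)
      then show ?thesis
        by (simp add: M_def exp_add[symmetric])
    qed
    finally show ?thesis .
  qed
  ultimately show ?thesis
    using that by blast
qed

lemma theta_term_uniform_limit:
  assumes "\<tau> \<in> upper_half_plane"
  shows "uniform_limit {z. \<bar>Im z\<bar> \<le> R} (\<lambda>X z. \<Sum>r\<in>X. theta_term \<tau> r z) (jacobi_theta \<tau>)
    (finite_subsets_at_top UNIV)"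
proof -
  obtain M where M: "M summable_on UNIV" "\<And>r z. \<bar>Im z\<bar> \<le> R \<Longrightarrow> norm (theta_term \<tau> r z) \<le> M r"
    using theta_term_bound[OF assms, of R] by blast
  show ?thesis
    unfolding jacobi_theta_altdef[abs_def] using M by (intro Weierstrass_m_test_general) auto
qed

text \<open>Every closed unit disc lies in a horizontal strip, so the finite partial sums, directed
  by inclusion, converge uniformly on it.\<close>

lemma holomorphic_jacobi_theta:
  assumes "\<tau> \<in> upper_half_plane"
  shows "jacobi_theta \<tau> holomorphic_on UNIV"
proof -
  have "jacobi_theta \<tau> holomorphic_on ball z 1" for z
  proof -
    have hol: "(\<lambda>z. \<Sum>r\<in>X. theta_term \<tau> r z) holomorphic_on A" for X A
      unfolding theta_term_def by (intro holomorphic_intros)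
    have "cball z 1 \<subseteq> {w. \<bar>Im w\<bar> \<le> \<bar>Im z\<bar> + 1}"
    proof
      fix w assume "w \<in> cball z 1"
      then have "\<bar>Im (w - z)\<bar> \<le> 1"
        using abs_Im_le_cmod[of "w - z"] by (auto simp: dist_norm norm_minus_commute)
      then show "w \<in> {w. \<bar>Im w\<bar> \<le> \<bar>Im z\<bar> + 1}" by auto
    qed
    then have "uniform_limit (cball z 1) (\<lambda>X z. \<Sum>r\<in>X. theta_term \<tau> r z) (jacobi_theta \<tau>)
        (finite_subsets_at_top UNIV)"
      by (rule uniform_limit_on_subset[OF theta_term_uniform_limit[OF assms]])
    then show ?thesis
      by (rule holomorphic_uniform_limit[rotated])
        (auto intro!: always_eventually hol holomorphic_on_imp_continuous_on)
  qed
  then show ?thesis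
    by (metis UNIV_I analytic_on_def analytic_on_open open_UNIV zero_less_one)
qed

section \<open>Symmetry, quasi-periodicity and nonvanishing of theta\<close>

text \<open>The character modulo 4 is odd, so replacing r by -r flips the sign. Oddness gives the
  zero at 0 and later the signs of the \<vartheta> with negative index.\<close>

lemma jacobi_theta_minus: "jacobi_theta \<tau> (- z) = - jacobi_theta \<tau> z"
proof -
  have k: "kronecker_m4 (- r) = - kronecker_m4 r" for r
  proof -
    have "r mod 4 \<in> {0, 1, 2, 3}" by auto
    then show ?thesis
      by (auto simp: kronecker_m4_def zmod_zminus1_eq_if)
  qed
  have "jacobi_theta \<tau> (- z) = (\<Sum>\<^sub>\<infinity>r. theta_term \<tau> (- r) (- z))"
    unfolding jacobi_theta_altdef
    by (subst infsum_reindex_bij_betw[of uminus UNIV UNIV, symmetric])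
      (auto simp: bij_uminus)
  also have "\<dots> = (\<Sum>\<^sub>\<infinity>r. - theta_term \<tau> r z)"
    by (simp add: theta_term_def k)
  also have "\<dots> = - jacobi_theta \<tau> z"
    unfolding jacobi_theta_altdef by (rule infsum_uminus)
  finally show ?thesis .
qed

text \<open>Only odd r contribute, and for these exp (\<pi> i r) = -1.\<close>

lemma jacobi_theta_plus_1: "jacobi_theta \<tau> (z + 1) = - jacobi_theta \<tau> z"
proof -
  have "theta_term \<tau> r (z + 1) = - theta_term \<tau> r z" for r
  proof (cases "even r")
    case True
    then have "r mod 4 \<noteq> 1" "r mod 4 \<noteq> 3"
      by presburger+
    then show ?thesis
      by (simp add: theta_term_def kronecker_m4_def)
  next
    case False
    then obtain k where r: "r = 2 * k + 1"
      by (auto elim: oddE)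
    have "exp (2 * of_real pi * \<i> * (z + 1) * (of_int r / 2)) =
        exp (2 * of_real pi * \<i> * z * (of_int r / 2)) * (exp_2pi_i (of_int k) * exp (of_real pi * \<i>))"
      unfolding exp_2pi_i_def exp_add[symmetric] by (simp add: r field_simps)
    also have "\<dots> = - exp (2 * of_real pi * \<i> * z * (of_int r / 2))"
      by (simp add: exp_2pi_i_eq_1_iff[THEN iffD2])
    finally show ?thesis
      by (simp add: theta_term_def)
  qed
  then show ?thesis
    unfolding jacobi_theta_altdef by (simp add: infsum_uminus)
qed

text \<open>Completing the square, r^2/8 + r/2 = (r + 2)^2/8 - 1/2, turns the shift of z into the
  shift of r by 2, under which the character changes sign.\<close>

lemma jacobi_theta_plus_tau:
  "jacobi_theta \<tau> (z + \<tau>) = - exp (- of_real pi * \<i> * \<tau>) * exp_2pi_i (- z) * jacobi_theta \<tau> z"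
proof -
  define c where "c = - exp (- of_real pi * \<i> * \<tau>) * exp_2pi_i (- z)"
  have shift: "theta_term \<tau> r (z + \<tau>) = c * theta_term \<tau> (r + 2) z" for r
  proof -
    have "(r + 2) mod 4 = (if r mod 4 < 2 then r mod 4 + 2 else r mod 4 - 2)"
      by presburger
    then have k: "kronecker_m4 r = - kronecker_m4 (r + 2)"
      by (auto simp: kronecker_m4_def)
    have "exp (2 * of_real pi * \<i> * \<tau> * (of_int r ^ 2 / 8)) * exp (2 * of_real pi * \<i> * (z + \<tau>) * (of_int r / 2)) =
       (exp (- of_real pi * \<i> * \<tau>) * exp_2pi_i (- z)) *
        (exp (2 * of_real pi * \<i> * \<tau> * (of_int (r + 2) ^ 2 / 8)) * exp (2 * of_real pi * \<i> * z * (of_int (r + 2) / 2)))"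
      unfolding exp_2pi_i_def exp_add[symmetric]
      by (rule arg_cong[of _ _ exp]) (simp add: field_simps power2_eq_square)
    then show ?thesis
      by (simp add: theta_term_def k c_def mult.assoc)
  qed
  have "jacobi_theta \<tau> (z + \<tau>) = (\<Sum>\<^sub>\<infinity>r. c * theta_term \<tau> (r + 2) z)"
    by (simp add: jacobi_theta_altdef shift)
  also have "\<dots> = c * (\<Sum>\<^sub>\<infinity>r. theta_term \<tau> (r + 2) z)"
    by (rule infsum_cmult_right')
  also have "(\<Sum>\<^sub>\<infinity>r. theta_term \<tau> (r + 2) z) = jacobi_theta \<tau> z"
    unfolding jacobi_theta_altdef
    by (rule infsum_reindex_bij_betw[of "\<lambda>r. r + 2" UNIV UNIV]) (simp add: bij_plus_right)
  finally show ?thesis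
    by (simp add: c_def)
qed

text \<open>The integral of \<open>\<theta>(z) \<zeta>\<^bsup>-1/2\<^esup>\<close> over the segment from 0 to 1 picks out the Fourier
  coefficient \<open>q\<^bsup>1/8\<^esup>\<close>.\<close>

lemma jacobi_theta_not_identically_0:
  assumes "\<tau> \<in> upper_half_plane"
  obtains z where "jacobi_theta \<tau> z \<noteq> 0"
proof -
  define e where "e = (\<lambda>z. exp (- of_real pi * \<i> * z))"
  define c where "c = exp (2 * of_real pi * \<i> * \<tau> * (1 / 8))"
  define S where "S = path_image (linepath 0 (1::complex))"
  have norm_e: "norm (e z) = 1" and Im: "Im z = 0" if "z \<in> S" for z
    using that by (auto simp: e_def S_def closed_segment_def)
  \<comment> \<open>Terms with even r vanish and r = 1 gives a constant. Any other odd r gives a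
    multiple of exp (b z) with exp b = 1, whose primitive agrees at both endpoints.\<close>
  have int: "((\<lambda>z. e z * theta_term \<tau> r z) has_contour_integral (if r = 1 then c else 0))
      (linepath 0 1)" for r
  proof (cases "even r")
    case True
    then have "r mod 4 \<noteq> 1" "r mod 4 \<noteq> 3" "r \<noteq> 1"
      by presburger+
    then show ?thesis
      by (simp add: theta_term_def kronecker_m4_def has_contour_integral_0)
  next
    case False
    then obtain k where r: "r = 2 * k + 1"
      by (auto elim: oddE)
    define a where "a = kronecker_m4 r * exp (2 * of_real pi * \<i> * \<tau> * (of_int r ^ 2 / 8))"
    have eq: "e z * theta_term \<tau> r z = a * exp_2pi_i (of_int k * z)" for z
    proof -
      have "e z * exp (2 * of_real pi * \<i> * z * (of_int r / 2)) = exp_2pi_i (of_int k * z)"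
        unfolding e_def exp_2pi_i_def exp_add[symmetric] by (simp add: r field_simps)
      then show ?thesis
        unfolding theta_term_def a_def by (simp add: mult_ac)
    qed
    show ?thesis
    proof (cases "k = 0")
      case True
      then have "e z * theta_term \<tau> r z = c" for z
        unfolding eq by (simp add: a_def c_def r kronecker_m4_def)
      then show ?thesis
        using has_contour_integral_const_linepath[where a = 0 and b = 1 and c = c] True by (simp add: r)
    next
      case False
      define b where "b = 2 * of_real pi * \<i> * of_int k"
      have b: "b \<noteq> 0"
        using False by (simp add: b_def)
      have eq': "e z * theta_term \<tau> r z = a * exp (b * z)" for z
        unfolding eq by (simp add: exp_2pi_i_def b_def mult_ac)
      have "exp b = 1"
        using exp_2pi_i_eq_1_iff[of "of_int k"] by (simp add: exp_2pi_i_def b_def)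
      have "((\<lambda>z. a * exp (b * z)) has_contour_integral
          (a / b * exp (b * pathfinish (linepath 0 1)) - a / b * exp (b * pathstart (linepath 0 1)))) (linepath 0 1)"
        by (rule contour_integral_primitive[where S = UNIV, OF _ valid_path_linepath])
          (auto intro!: derivative_eq_intros simp: b)
      with \<open>exp b = 1\<close> have "((\<lambda>z. a * exp (b * z)) has_contour_integral 0) (linepath 0 1)"
        by simp
      moreover have "r \<noteq> 1"
        using False by (simp add: r)
      ultimately show ?thesis
        by (simp only: eq' if_False)
    qed
  qed
  \<comment> \<open>On the segment z is real and \<open>e z\<close> has modulus 1, so the majorant
    for R = 0 also bounds the twisted terms.\<close>
  obtain M where M: "M summable_on UNIV" "\<And>r z. \<bar>Im z\<bar> \<le> 0 \<Longrightarrow> norm (theta_term \<tau> r z) \<le> M r"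
    using theta_term_bound[OF assms, of 0] by blast
  have "uniform_limit S (\<lambda>X z. \<Sum>r\<in>X. e z * theta_term \<tau> r z)
      (\<lambda>z. \<Sum>\<^sub>\<infinity>r. e z * theta_term \<tau> r z) (finite_subsets_at_top UNIV)"
    using M norm_e Im by (intro Weierstrass_m_test_general) (auto simp: norm_mult)
  also have "(\<lambda>z. \<Sum>\<^sub>\<infinity>r. e z * theta_term \<tau> r z) = (\<lambda>z. e z * jacobi_theta \<tau> z)"
    by (simp add: jacobi_theta_altdef infsum_cmult_right')
  finally have lim: "uniform_limit S (\<lambda>X z. \<Sum>r\<in>X. e z * theta_term \<tau> r z)
    (\<lambda>z. e z * jacobi_theta \<tau> z) (finite_subsets_at_top UNIV)" .
  have cont: "continuous_on S (\<lambda>z. \<Sum>r\<in>X. e z * theta_term \<tau> r z)" for X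
    unfolding e_def theta_term_def by (intro continuous_intros)
  obtain I J where IJ: "\<And>X. ((\<lambda>z. \<Sum>r\<in>X. e z * theta_term \<tau> r z) has_contour_integral I X) (linepath 0 1)"
    "((\<lambda>z. e z * jacobi_theta \<tau> z) has_contour_integral J) (linepath 0 1)"
    "(I \<longlongrightarrow> J) (finite_subsets_at_top UNIV)"
    using uniform_limit_contour_integral_linepath[OF lim[unfolded S_def] cont[unfolded S_def]
        finite_subsets_at_top_neq_bot] by blast
  have "I X = (\<Sum>r\<in>X. if r = 1 then c else 0)" if "finite X" for X
    by (rule has_contour_integral_unique[OF IJ(1) has_contour_integral_sum[OF that int]])
  \<comment> \<open>The net of integrals is constant as soon as the index set contains 1, so its
    limit is the Fourier coefficient.\<close>
  then have "I X = c" if "finite X" "{1} \<subseteq> X" for X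
    using that by (simp add: sum.delta)
  then have "\<forall>\<^sub>F X in finite_subsets_at_top UNIV. I X = c"
    unfolding eventually_finite_subsets_at_top by (intro exI[of _ "{1}"]) auto
  then have "J = c"
    by (intro tendsto_unique[OF finite_subsets_at_top_neq_bot IJ(3)] tendsto_eventually)
  moreover have "J = 0" if "\<And>z. jacobi_theta \<tau> z = 0"
    using contour_integral_unique[OF IJ(2)] that by simp
  moreover have "c \<noteq> 0"
    by (simp add: c_def)
  ultimately show ?thesis
    using that by blast
qed

section \<open>Comparison of theta with the product by Liouville's theorem\<close>

lemma period_lattice_add:
  "x \<in> period_lattice \<tau> \<Longrightarrow> y \<in> period_lattice \<tau> \<Longrightarrow> x + y \<in> period_lattice \<tau>"
proof -
  assume "x \<in> period_lattice \<tau>" "y \<in> period_lattice \<tau>"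
  then obtain m n m' n' :: int where "x = of_int m * \<tau> + of_int n" "y = of_int m' * \<tau> + of_int n'"
    unfolding period_lattice_iff by blast
  then have "x + y = of_int (m + m') * \<tau> + of_int (n + n')"
    by (simp add: algebra_simps)
  then show ?thesis
    unfolding period_lattice_iff by blast
qed

lemma period_lattice_of_int_mult: "x \<in> period_lattice \<tau> \<Longrightarrow> of_int k * x \<in> period_lattice \<tau>"
proof -
  assume "x \<in> period_lattice \<tau>"
  then obtain m n :: int where "x = of_int m * \<tau> + of_int n"
    unfolding period_lattice_iff by blast
  then have "of_int k * x = of_int (k * m) * \<tau> + of_int (k * n)"
    by (simp add: algebra_simps)
  then show ?thesis
    unfolding period_lattice_iff by blast
qed

lemma zero_in_period_lattice: "0 \<in> period_lattice \<tau>"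
  unfolding period_lattice_iff by (intro exI[of _ 0]) auto

lemma holomorphic_on_UNIV_imp_analytic_on: "f holomorphic_on UNIV \<Longrightarrow> f analytic_on A"
  by (metis analytic_on_open analytic_on_subset open_UNIV subset_UNIV)

lemma jacobi_theta_0: "jacobi_theta \<tau> 0 = 0"
  using jacobi_theta_minus[of \<tau> 0] by simp

text \<open>The codomain is arbitrary, so that this also applies to predicates, such as vanishing at
  z, and to orders.\<close>

lemma periodic_int:
  fixes g :: "complex \<Rightarrow> 'a"
  assumes "\<And>z. g (z + \<omega>) = g z"
  shows "g (z + of_int k * \<omega>) = g z"
proof (induction k arbitrary: z rule: int_induct[where k = 0])
  case (step1 i)
  then show ?case
    using assms[of "z + of_int i * \<omega>"] by (simp add: algebra_simps)
next
  case (step2 i)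
  then show ?case
    using assms[of "z + of_int (i - 1) * \<omega>"] by (simp add: algebra_simps)
qed auto

text \<open>The multipliers for both periods are nonzero, so vanishing is a doubly periodic
  predicate, and it holds at 0.\<close>

lemma jacobi_theta_period_lattice:
  assumes "z \<in> period_lattice \<tau>"
  shows "jacobi_theta \<tau> z = 0"
proof -
  obtain m n :: int where z: "z = 0 + of_int m * \<tau> + of_int n * 1"
    using assms unfolding period_lattice_iff by auto
  show ?thesis
    unfolding z
    using periodic_int[of "\<lambda>z. jacobi_theta \<tau> z = 0" 1 "0 + of_int m * \<tau>" n]
      periodic_int[of "\<lambda>z. jacobi_theta \<tau> z = 0" \<tau> 0 m]
    by (simp add: jacobi_theta_plus_1 jacobi_theta_plus_tau jacobi_theta_0)
qed

text \<open>All values are attained on a compact set containing a fundamental parallelogram, so the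
  function is bounded and Liouville applies.\<close>

lemma entire_elliptic_constant:
  assumes "\<tau> \<in> upper_half_plane" and "g holomorphic_on UNIV"
    and one: "\<And>z. g (z + 1) = g z" and tau: "\<And>z. g (z + \<tau>) = g z"
  obtains c where "\<And>z. g z = c"
proof -
  have y: "Im \<tau> > 0"
    using assms by (simp add: upper_half_plane_def)
  have "\<exists>w. norm w \<le> 1 + norm \<tau> \<and> g z = g w" for z
  proof -
    \<comment> \<open>s and t are the real coordinates of z in the basis \<tau>, 1; their fractional
      parts give the reduced point \<open>w\<close>.\<close>
    define s where "s = Im z / Im \<tau>"
    define t where "t = Re z - s * Re \<tau>"
    have z: "z = of_real s * \<tau> + of_real t"
      using y by (auto simp: complex_eq_iff s_def t_def)
    define w where "w = of_real (frac s) * \<tau> + of_real (frac t)"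
    have "z = w + of_int \<lfloor>s\<rfloor> * \<tau> + of_int \<lfloor>t\<rfloor> * 1"
      by (simp add: z w_def frac_def algebra_simps)
    then have "g z = g w"
      by (simp only: periodic_int[of g 1, OF one] periodic_int[of g \<tau>, OF tau])
    moreover have "norm w \<le> 1 * norm \<tau> + 1"
      unfolding w_def
      by (intro norm_triangle_mono; simp only: norm_mult norm_of_real)
         (use frac_lt_1[of s] frac_lt_1[of t] frac_ge_0[of s] frac_ge_0[of t] in
          \<open>auto intro!: mult_right_mono mult_left_le_one_le\<close>)
    ultimately show ?thesis
      by (intro exI[of _ w]) auto
  qed
  then have "range g \<subseteq> g ` cball 0 (1 + norm \<tau>)"
    by fastforce
  moreover have "compact (g ` cball 0 (1 + norm \<tau>))"
    by (intro compact_continuous_image holomorphic_on_imp_continuous_on)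
       (auto intro: holomorphic_on_subset[OF assms(2)])
  ultimately have "bounded (range g)"
    by (meson bounded_subset compact_imp_bounded)
  with assms(2) have "g constant_on UNIV"
    by (rule Liouville_theorem)
  then show ?thesis
    using that by (auto simp: constant_on_def)
qed

lemma jacobi_theta_eq_cmult_theta_product:
  assumes "\<tau> \<in> upper_half_plane"
  obtains c where "c \<noteq> 0" "\<And>z. jacobi_theta \<tau> z = c * theta_product \<tau> z"
proof -
  note \<tau> = assms
  define g where "g = (\<lambda>z. jacobi_theta \<tau> z / theta_product \<tau> z)"
  have hol: "jacobi_theta \<tau> analytic_on {z}" "theta_product \<tau> analytic_on {z}" for z
    by (intro holomorphic_on_UNIV_imp_analytic_on holomorphic_jacobi_theta holomorphic_theta_product \<tau>)+
  have one: "g (z + 1) = g z" for z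
    by (simp add: g_def jacobi_theta_plus_1 theta_product_plus_1)
  have tau: "g (z + \<tau>) = g z" for z
    by (simp add: g_def jacobi_theta_plus_tau theta_product_plus_tau[OF \<tau>])
  obtain D where D: "D \<noteq> 0" "(theta_product \<tau> has_field_derivative D) (at 0)"
    using theta_product_simple_zero_0[OF \<tau>] .
  obtain E where E: "(jacobi_theta \<tau> has_field_derivative E) (at 0)"
    using holomorphic_derivI[OF holomorphic_jacobi_theta[OF \<tau>]] by blast
  \<comment> \<open>Both functions vanish at 0 and the denominator does so to first order, so
    l'Hopital gives a finite limit.\<close>
  have lim0: "g \<midarrow>0\<rightarrow> E / D"
    unfolding g_def
    using theta_product_eq_0_iff[OF \<tau>] zero_in_period_lattice
    by (intro lhopital_complex_simple[OF E D(2)]) (auto simp: D jacobi_theta_0)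
  have lattice: "g (z + \<omega>) = g z" if "\<omega> \<in> period_lattice \<tau>" for \<omega> z
  proof -
    obtain m n :: int where "\<omega> = of_int m * \<tau> + of_int n"
      using \<open>\<omega> \<in> _\<close> unfolding period_lattice_iff by blast
    then have "z + \<omega> = z + of_int m * \<tau> + of_int n * 1"
      by simp
    then show ?thesis
      by (simp only: periodic_int[of g 1, OF one] periodic_int[of g \<tau>, OF tau])
  qed
  \<comment> \<open>At lattice points the limit at 0 is transported by periodicity; elsewhere the
    denominator is nonzero.\<close>
  have lim: "\<exists>l. g \<midarrow>z\<rightarrow> l" for z
  proof (cases "z \<in> period_lattice \<tau>")
    case True
    have "(\<lambda>w. g (w + z)) \<midarrow>0\<rightarrow> E / D"
      using lim0 by (simp add: lattice[OF True])
    then have "g \<midarrow>z\<rightarrow> E / D"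
      using LIM_offset_zero_cancel[of g z "E / D"] by (simp add: add.commute)
    then show ?thesis ..
  next
    case False
    then have "g analytic_on {z}"
      unfolding g_def using hol theta_product_eq_0_iff[OF \<tau>] by (intro analytic_intros) auto
    then show ?thesis
      using analytic_at_imp_isCont isContD by blast
  qed
  have iso: "isolated_singularity_at g z" for z
    unfolding g_def using hol by (intro singularity_intros isolated_singularity_at_analytic not_essential_analytic)
  \<comment> \<open>At lattice points \<open>g\<close> has the default value of division by 0;
    removing the singularities yields the entire function.\<close>
  define h where "h = remove_sings g"
  have shift: "h (z + \<omega>) = h z" if "\<And>z. g (z + \<omega>) = g z" for \<omega> z
  proof -
    have "g (z + \<omega> + w) = g (z + w)" for w
      using that[of "z + w"] by (simp add: add_ac)
    then show ?thesis
      unfolding h_def remove_sings_shift_0[of g "z + \<omega>"] remove_sings_shift_0[of g z] by simp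
  qed
  have "h analytic_on {z}" for z
    unfolding h_def using remove_sings_analytic_at[OF iso] lim by blast
  then have "h holomorphic_on UNIV"
    by (metis analytic_imp_holomorphic analytic_on_analytic_at)
  then obtain c where c: "\<And>z. h z = c"
    using entire_elliptic_constant[OF \<tau>] shift one tau by metis
  have *: "jacobi_theta \<tau> z = c * theta_product \<tau> z" for z
  \<comment> \<open>Off the lattice \<open>h\<close> agrees with the quotient; on the lattice both
    sides of the identity vanish.\<close>
  proof (cases "z \<in> period_lattice \<tau>")
    case False
    then have nz: "theta_product \<tau> z \<noteq> 0"
      using theta_product_eq_0_iff[OF \<tau>] by blast
    then have "g analytic_on {z}"
      unfolding g_def using hol by (intro analytic_intros) auto
    then have "g z = c"
      using c[of z] by (simp add: h_def)
    then show ?thesis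
      using nz by (simp add: g_def field_simps)
  next
    case True
    then show ?thesis
      using jacobi_theta_period_lattice[OF True] theta_product_eq_0_iff[OF \<tau>] by simp
  qed
  obtain z where "jacobi_theta \<tau> z \<noteq> 0"
    using jacobi_theta_not_identically_0[OF \<tau>] .
  then have "c \<noteq> 0"
    using * by auto
  with * show ?thesis
    using that by blast
qed

lemma jacobi_theta_eq_0_iff:
  assumes "\<tau> \<in> upper_half_plane"
  shows "jacobi_theta \<tau> z = 0 \<longleftrightarrow> z \<in> period_lattice \<tau>"
  using jacobi_theta_eq_cmult_theta_product[OF assms] theta_product_eq_0_iff[OF assms]
  by (metis mult_eq_0_iff)

section \<open>Orders of vanishing of theta and its rescalings\<close>

lemma analytic_jacobi_theta:
  assumes "\<tau> \<in> upper_half_plane"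
  shows "jacobi_theta \<tau> analytic_on A"
  by (intro holomorphic_on_UNIV_imp_analytic_on holomorphic_jacobi_theta assms)

lemma eventually_jacobi_theta_nonzero:
  assumes "\<tau> \<in> upper_half_plane"
  shows "\<forall>\<^sub>F w in at z. jacobi_theta \<tau> w \<noteq> 0"
proof -
  obtain z0 where z0: "jacobi_theta \<tau> z0 \<noteq> 0"
    using jacobi_theta_not_identically_0[OF assms] .
  show ?thesis
    using non_zero_neighbour_alt[OF holomorphic_jacobi_theta[OF assms] _ _ _ _ z0] by auto
qed

lemma zorder_jacobi_theta_plus_1: "zorder (jacobi_theta \<tau>) (z + 1) = zorder (jacobi_theta \<tau>) z"
proof -
  have "zorder (jacobi_theta \<tau>) (z + 1) = zorder (\<lambda>u. jacobi_theta \<tau> (u + (z + 1))) 0"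
    by (rule zorder_shift)
  also have "\<dots> = zorder (\<lambda>u. - jacobi_theta \<tau> (u + z)) 0"
    by (simp add: add.assoc[symmetric] jacobi_theta_plus_1)
  also have "\<dots> = zorder (jacobi_theta \<tau>) z"
    by (simp add: zorder_shift[of _ z, symmetric])
  finally show ?thesis .
qed

text \<open>The multiplier \<open>e\<close> is analytic without zeros, so it contributes order
  0.\<close>

lemma zorder_jacobi_theta_plus_tau:
  assumes "\<tau> \<in> upper_half_plane"
  shows "zorder (jacobi_theta \<tau>) (z + \<tau>) = zorder (jacobi_theta \<tau>) z"
proof -
  define e where "e = (\<lambda>z. - exp (- of_real pi * \<i> * \<tau>) * exp_2pi_i (- z))"
  have e: "e analytic_on A" for A
    unfolding e_def exp_2pi_i_def by (intro analytic_intros)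
  have nz: "e w \<noteq> 0" for w
    by (simp add: e_def)
  have "zorder (jacobi_theta \<tau>) (z + \<tau>) = zorder (\<lambda>u. jacobi_theta \<tau> (u + (z + \<tau>))) 0"
    by (rule zorder_shift)
  also have "\<dots> = zorder (\<lambda>u. e (u + z) * jacobi_theta \<tau> (u + z)) 0"
    by (simp add: add.assoc[symmetric] jacobi_theta_plus_tau e_def)
  also have "\<dots> = zorder (\<lambda>u. e u * jacobi_theta \<tau> u) z"
    by (rule zorder_shift[symmetric])
  also have "\<dots> = zorder e z + zorder (jacobi_theta \<tau>) z"
    using nz eventually_jacobi_theta_nonzero[OF assms]
    by (intro zorder_mult analytic_on_imp_meromorphic_on e analytic_jacobi_theta assms)
      (auto intro!: eventually_frequently)
  also have "zorder e z = 0"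
    using e nz by (intro zorder_eq_0I)
  finally show ?thesis by simp
qed

lemma zorder_jacobi_theta:
  assumes "\<tau> \<in> upper_half_plane"
  shows "zorder (jacobi_theta \<tau>) z = (if z \<in> period_lattice \<tau> then 1 else 0)"
proof (cases "z \<in> period_lattice \<tau>")
  case False
  then show ?thesis
    using jacobi_theta_eq_0_iff[OF assms] analytic_jacobi_theta[OF assms] zorder_eq_0I by auto
next
  case True
  then obtain m n :: int where z: "z = 0 + of_int m * \<tau> + of_int n * 1"
    unfolding period_lattice_iff by auto
  obtain c where c: "c \<noteq> 0" "\<And>z. jacobi_theta \<tau> z = c * theta_product \<tau> z"
    using jacobi_theta_eq_cmult_theta_product[OF assms] by blast
  obtain D where D: "D \<noteq> 0" "(theta_product \<tau> has_field_derivative D) (at 0)"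
    using theta_product_simple_zero_0[OF assms] .
  \<comment> \<open>The nonzero derivative gives order 1 at 0, and periodicity of the order carries
    this to all lattice points.\<close>
  have "((\<lambda>z. c * theta_product \<tau> z) has_field_derivative c * D) (at 0)"
    by (rule DERIV_cmult[OF D(2)])
  then have "deriv (jacobi_theta \<tau>) 0 \<noteq> 0"
    using c(1) D(1) by (simp add: c(2)[abs_def] DERIV_imp_deriv)
  then have "zorder (jacobi_theta \<tau>) 0 = 1"
    using jacobi_theta_0[of \<tau>] analytic_jacobi_theta[OF assms]
    by (intro zorder_zero_eqI') auto
  moreover have "zorder (jacobi_theta \<tau>) z = zorder (jacobi_theta \<tau>) 0"
    unfolding z using periodic_int[of "zorder (jacobi_theta \<tau>)", OF zorder_jacobi_theta_plus_1]
      periodic_int[of "zorder (jacobi_theta \<tau>)", OF zorder_jacobi_theta_plus_tau[OF assms]] by metis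
  ultimately show ?thesis
    using True by simp
qed

text \<open>Scaling by a nonzero integer preserves orders, so every a-division point is a simple
  zero.\<close>

lemma zorder_theta_scaled:
  assumes "\<tau> \<in> upper_half_plane" "a \<noteq> 0"
  shows "zorder (theta_scaled a \<tau>) z = (if of_int a * z \<in> period_lattice \<tau> then 1 else 0)"
  unfolding theta_scaled_def
  using assms analytic_on_imp_meromorphic_on[OF analytic_jacobi_theta]
  by (subst zorder_scale) (auto simp: zorder_jacobi_theta)

lemma theta_scaled_uminus: "theta_scaled (- a) \<tau> z = - theta_scaled a \<tau> z"
  by (simp add: theta_scaled_def jacobi_theta_minus)

lemma analytic_theta_scaled:
  assumes "\<tau> \<in> upper_half_plane"
  shows "theta_scaled a \<tau> analytic_on A"
proof -
  have "(\<lambda>z. jacobi_theta \<tau> (of_int a * z)) holomorphic_on UNIV"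
    using holomorphic_on_compose_gen[OF _ holomorphic_jacobi_theta[OF assms], of "(*) (of_int a)" UNIV]
    by (auto simp: o_def intro!: holomorphic_intros)
  then show ?thesis
    unfolding theta_scaled_def[abs_def]
    by (rule holomorphic_on_UNIV_imp_analytic_on)
qed

text \<open>Scaling by nonzero a maps punctured neighbourhoods into punctured neighbourhoods. Hence
  division by these functions is harmless off isolated points.\<close>

lemma eventually_theta_scaled_nonzero:
  assumes "\<tau> \<in> upper_half_plane" "a \<noteq> 0"
  shows "\<forall>\<^sub>F w in at z. theta_scaled a \<tau> w \<noteq> 0"
proof -
  have "filterlim (\<lambda>w. of_int a * w) (at (of_int a * z)) (at z)"
    using assms(2) by (auto simp: filterlim_at eventually_at_filter intro!: tendsto_intros)
  with eventually_jacobi_theta_nonzero[OF assms(1)] show ?thesis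
    unfolding theta_scaled_def by (rule eventually_compose_filterlim)
qed

subsection \<open>Moebius inversion\<close>

text \<open>A new prime factor preserves squarefreeness and raises the number of prime factors by
  one.\<close>

lemma moebius_prime_mult:
  assumes "prime p" "\<not> p dvd d" 
  shows "moebius (p * d) = - moebius d"
proof -
  have d: "d > 0" "coprime p d" and p: "p > 0"
    using assms by (auto simp: prime_imp_coprime intro: Nat.gr0I prime_gt_0_nat)
  have sq: "squarefree (p * d) \<longleftrightarrow> squarefree d"
    using d assms by (auto simp: squarefree_mult_coprime squarefree_prime dest: squarefree_multD)
  have "prime_factors (p * d) = insert p (prime_factors d)"
    using d p assms by (simp add: prime_factors_product prime_prime_factors)
  moreover have "p \<notin> prime_factors d"
    using assms by (auto simp: in_prime_factors_iff)
  ultimately show ?thesis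
    by (simp add: moebius_def sq)
qed

text \<open>For a fixed prime p dividing n, the terms of d and p d with p not dividing d cancel. The
  remaining divisors are divisible by p^2 and contribute 0.\<close>

lemma sum_moebius_divisors:
  fixes n :: nat
  assumes "n > 0"
  shows "(\<Sum>d | d dvd n. moebius d) = (if n = 1 then 1 else 0)"
proof (cases "n = 1")
  case True
  then show ?thesis by (simp add: moebius_def)
next
  case False
  then obtain p where p: "prime p" "p dvd n"
    using prime_factor_nat by blast
  have fin: "finite {d. d dvd n}"
    using assms by simp
  define A where "A = {d. d dvd n \<and> \<not> p dvd d}"
  define B where "B = {d. d dvd n \<and> p dvd d}"
  have "(\<Sum>d | d dvd n. moebius d) = sum moebius A + sum moebius B"
    unfolding A_def B_def
    by (subst sum.union_disjoint[symmetric]) (use fin in \<open>auto intro!: sum.cong\<close>)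
  also have "sum moebius B = sum moebius ((*) p ` A)"
  proof (rule sum.mono_neutral_right)
    show "finite B" using fin by (simp add: B_def)
    show "(*) p ` A \<subseteq> B"
      using p by (auto simp: A_def B_def intro!: divides_mult prime_imp_coprime)
    show "\<forall>d\<in>B - (*) p ` A. moebius d = 0"
    proof
      fix d assume d: "d \<in> B - (*) p ` A"
      then obtain e where e: "d = p * e" "d dvd n"
        by (auto simp: B_def elim: dvdE)
      then have "e dvd n" by auto
      with d e have "p dvd e"
        by (auto simp: A_def)
      then have "p\<^sup>2 dvd d"
        by (auto simp: e power2_eq_square)
      then have "\<not> squarefree d"
        using p(1) by (auto simp: squarefree_def dest: prime_gt_1_nat)
      then show "moebius d = 0"
        by (simp add: moebius_def)
    qed
  qed
  also have "\<dots> = (\<Sum>d\<in>A. moebius (p * d))"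
    using p(1) by (subst sum.reindex) (auto simp: inj_on_def dest: prime_gt_0_nat)
  also have "\<dots> = - sum moebius A"
    unfolding sum_negf[symmetric] using moebius_prime_mult[OF p(1)]
    by (intro sum.cong) (auto simp: A_def)
  finally show ?thesis
    using False by simp
qed

text \<open>Both sums run over the divisors k of a/e, through d = e k and d = a/k respectively. They
  are the entries of the two products of the divisibility matrix with its inverse.\<close>

lemma sum_moebius_between:
  fixes a e :: nat
  assumes "a > 0"
  shows "(\<Sum>d | d dvd a. if e dvd d then moebius (d div e) else 0) = (if e = a then 1 else 0)"
    and "(\<Sum>d | d dvd a. if e dvd d then moebius (a div d) else 0) = (if e = a then 1 else 0)"
proof -
  have fin: "finite {d. d dvd a}"
    using assms by simp
  have restrict: "(\<Sum>d | d dvd a. if e dvd d then f d else 0) = sum f {d. d dvd a \<and> e dvd d}"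
    for f :: "nat \<Rightarrow> int"
    using fin by (subst sum.inter_filter[symmetric]) auto
  have *: "sum (\<lambda>d. moebius (d div e)) {d. d dvd a \<and> e dvd d} = (if e = a then 1 else 0) \<and>
    sum (\<lambda>d. moebius (a div d)) {d. d dvd a \<and> e dvd d} = (if e = a then 1 else 0)"
  proof (cases "e dvd a")
    case False
    then have empty: "{d. d dvd a \<and> e dvd d} = {}"
      by (auto dest: dvd_trans)
    from False have "e \<noteq> a" by auto
    then show ?thesis by (simp only: empty) simp
  next
    case True
    then obtain n where n: "a = e * n"
      by (auto elim: dvdE)
    have pos: "e > 0" "n > 0"
      using assms n by auto
    have "sum (\<lambda>d. moebius (d div e)) {d. d dvd a \<and> e dvd d} = (\<Sum>k | k dvd n. moebius k)"
      by (rule sum.reindex_bij_witness[of _ "\<lambda>k. e * k" "\<lambda>d. d div e"]) (use pos in \<open>auto simp: n elim!: dvdE\<close>)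
    moreover have "sum (\<lambda>d. moebius (a div d)) {d. d dvd a \<and> e dvd d} = (\<Sum>k | k dvd n. moebius k)"
      by (rule sum.reindex_bij_witness[of _ "\<lambda>k. a div k" "\<lambda>d. a div d"]) (use pos in \<open>auto simp: n elim!: dvdE\<close>)
    ultimately show ?thesis
      using sum_moebius_divisors[OF pos(2)] pos by (auto simp: n)
  qed
  show "(\<Sum>d | d dvd a. if e dvd d then moebius (d div e) else 0) = (if e = a then 1 else 0)"
    unfolding restrict using * by blast
  show "(\<Sum>d | d dvd a. if e dvd d then moebius (a div d) else 0) = (if e = a then 1 else 0)"
    unfolding restrict using * by blast
qed

text \<open>\<open>divisor_frag a\<close> is the divisor of \<open>\<theta>\<^sub>a\<close>, and \<open>moebius_frag a\<close> records the exponents of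
  \<open>S\<^sub>a\<close>; their linear extensions are mutually inverse by Moebius inversion.\<close>

definition divisor_frag :: "nat \<Rightarrow> (nat \<Rightarrow>\<^sub>0 int)"
  where "divisor_frag a = (\<Sum>d | d dvd a. frag_of d)"

definition moebius_frag :: "nat \<Rightarrow> (nat \<Rightarrow>\<^sub>0 int)"
  where "moebius_frag a = (\<Sum>d | d dvd a. frag_cmul (moebius (a div d)) (frag_of d))"

lemma lookup_divisor_frag:
  "a > 0 \<Longrightarrow> Poly_Mapping.lookup (divisor_frag a) e = (if e dvd a then 1 else 0)"
  by (simp add: divisor_frag_def lookup_sum when_def)

lemma lookup_moebius_frag:
  "a > 0 \<Longrightarrow> Poly_Mapping.lookup (moebius_frag a) e = (if e dvd a then moebius (a div e) else 0)"
  by (simp add: moebius_frag_def lookup_sum when_def if_distrib cong: if_cong)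

lemma keys_divisor_frag: "a > 0 \<Longrightarrow> Poly_Mapping.keys (divisor_frag a) \<subseteq> {0<..}"
  by (auto simp: in_keys_iff lookup_divisor_frag intro!: Nat.gr0I split: if_splits)

lemma keys_moebius_frag: "a > 0 \<Longrightarrow> Poly_Mapping.keys (moebius_frag a) \<subseteq> {0<..}"
  by (auto simp: in_keys_iff lookup_moebius_frag intro!: Nat.gr0I split: if_splits)

text \<open>In terms of functions, \<open>S_prim a\<close> has divisor (a). The coefficient at e is
  the second sum of \<open>sum_moebius_between\<close>.\<close>

lemma frag_extend_divisor_moebius_frag:
  assumes "a > 0"
  shows "frag_extend divisor_frag (moebius_frag a) = frag_of a"
proof (rule poly_mapping_eqI)
  fix e
  have pos: "d > 0" if "d dvd a" for d
    using that assms by (auto intro: Nat.gr0I)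
  have "frag_extend divisor_frag (moebius_frag a) =
      (\<Sum>d | d dvd a. frag_cmul (moebius (a div d)) (divisor_frag d))"
    using assms by (simp add: moebius_frag_def frag_extend_sum frag_extend_cmul)
  also have "Poly_Mapping.lookup \<dots> e = (\<Sum>d | d dvd a. if e dvd d then moebius (a div d) else 0)"
    unfolding lookup_sum by (intro sum.cong) (auto simp: lookup_divisor_frag pos)
  also have "\<dots> = Poly_Mapping.lookup (frag_of a) e"
    using sum_moebius_between(2)[OF assms, of e] by (auto simp: when_def)
  finally show "Poly_Mapping.lookup (frag_extend divisor_frag (moebius_frag a)) e = Poly_Mapping.lookup (frag_of a) e" .
qed

text \<open>In terms of functions, \<vartheta> with index a is the product of the
  \<open>S_prim d\<close> over d dividing a. The coefficient at e is the first sum of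
  \<open>sum_moebius_between\<close>.\<close>

lemma frag_extend_moebius_divisor_frag:
  assumes "a > 0"
  shows "frag_extend moebius_frag (divisor_frag a) = frag_of a"
proof (rule poly_mapping_eqI)
  fix e
  have pos: "d > 0" if "d dvd a" for d
    using that assms by (auto intro: Nat.gr0I)
  have "frag_extend moebius_frag (divisor_frag a) = (\<Sum>d | d dvd a. moebius_frag d)"
    using assms by (simp add: divisor_frag_def frag_extend_sum)
  also have "Poly_Mapping.lookup \<dots> e = (\<Sum>d | d dvd a. if e dvd d then moebius (d div e) else 0)"
    unfolding lookup_sum by (intro sum.cong) (auto simp: lookup_moebius_frag pos)
  also have "\<dots> = Poly_Mapping.lookup (frag_of a) e"
    using sum_moebius_between(1)[OF assms, of e] by (auto simp: when_def)
  finally show "Poly_Mapping.lookup (frag_extend moebius_frag (divisor_frag a)) e = Poly_Mapping.lookup (frag_of a) e" .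
qed

text \<open>By linearity it suffices to check the composition on generators.\<close>

lemma frag_extend_frag_extend_inverse:
  assumes "\<And>x. x \<in> S \<Longrightarrow> frag_extend f (g x) = frag_of x" "Poly_Mapping.keys c \<subseteq> S"
  shows "frag_extend f (frag_extend g c) = c"
  using assms(2)
  by (induction c rule: frag_induction) (auto simp: frag_extend_diff assms(1))

text \<open>Sends the exponent vector of a product of \<vartheta> powers to its divisor.\<close>

definition theta_divisor :: "(nat \<Rightarrow>\<^sub>0 int) \<Rightarrow> (nat \<Rightarrow>\<^sub>0 int)"
  where "theta_divisor = frag_extend divisor_frag"

text \<open>Sends a divisor D to the exponent vector of \<open>S_Div D\<close>.\<close>

definition S_exponents :: "(nat \<Rightarrow>\<^sub>0 int) \<Rightarrow> (nat \<Rightarrow>\<^sub>0 int)"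
  where "S_exponents = frag_extend moebius_frag"

lemma theta_divisor_S_exponents:
  "Poly_Mapping.keys c \<subseteq> {0<..} \<Longrightarrow> theta_divisor (S_exponents c) = c"
  unfolding theta_divisor_def S_exponents_def
  by (rule frag_extend_frag_extend_inverse[of "{0<..}"]) (auto simp: frag_extend_divisor_moebius_frag)

lemma S_exponents_theta_divisor:
  "Poly_Mapping.keys c \<subseteq> {0<..} \<Longrightarrow> S_exponents (theta_divisor c) = c"
  unfolding theta_divisor_def S_exponents_def
  by (rule frag_extend_frag_extend_inverse[of "{0<..}"]) (auto simp: frag_extend_moebius_divisor_frag)

lemma keys_theta_divisor:
  "Poly_Mapping.keys c \<subseteq> {0<..} \<Longrightarrow> Poly_Mapping.keys (theta_divisor c) \<subseteq> {0<..}"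
  unfolding theta_divisor_def using keys_frag_extend[of divisor_frag c] keys_divisor_frag
  by (meson UN_least greaterThan_iff order_trans subsetD)

lemma keys_S_exponents:
  "Poly_Mapping.keys c \<subseteq> {0<..} \<Longrightarrow> Poly_Mapping.keys (S_exponents c) \<subseteq> {0<..}"
  unfolding S_exponents_def using keys_frag_extend[of moebius_frag c] keys_moebius_frag
  by (meson UN_least greaterThan_iff order_trans subsetD)

subsection \<open>Theta quotients and their divisors\<close>

text \<open>The multipliers carrying z into the lattice are the multiples of its exact order
  d.\<close>

lemma primitive_division_point_dvd_iff:
  assumes "primitive_division_point \<tau> d z"
  shows "of_nat a * z \<in> period_lattice \<tau> \<longleftrightarrow> d dvd a"
proof
  have d: "d > 0" "of_nat d * z \<in> period_lattice \<tau>"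
    and minimal: "\<And>e. 0 < e \<Longrightarrow> e < d \<Longrightarrow> of_nat e * z \<notin> period_lattice \<tau>"
    using assms by (auto simp: primitive_division_point_def)
  have multiple: "of_int (k * int d) * z \<in> period_lattice \<tau>" for k
    using period_lattice_of_int_mult[OF d(2), of k] by (simp add: mult.assoc)
  show "of_nat a * z \<in> period_lattice \<tau>" if "d dvd a"
  proof -
    obtain k where "a = k * d"
      using \<open>d dvd a\<close> by (metis dvdE mult.commute)
    then show ?thesis
      using multiple[of "int k"] by simp
  qed
  show "d dvd a" if "of_nat a * z \<in> period_lattice \<tau>"
  proof -
    \<comment> \<open>The remainder of a modulo d also carries z into the lattice, so minimality of
      d forces it to be 0.\<close>
    have "complex_of_nat a = of_nat (a div d) * of_nat d + of_nat (a mod d)"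
      by (metis of_nat_add of_nat_mult div_mult_mod_eq)
    then have "complex_of_nat (a mod d) = of_nat a + of_int (- int (a div d) * int d)"
      by (metis add.commute add_diff_cancel_left' diff_conv_add_uminus mult_minus_left
          of_int_minus of_int_mult of_int_of_nat_eq)
    then have "of_nat (a mod d) * z = of_nat a * z + of_int (- int (a div d) * int d) * z"
      by (simp only: ring_distribs)
    then have "of_nat (a mod d) * z \<in> period_lattice \<tau>"
      using period_lattice_add[OF that multiple] by (simp only:)
    then have "a mod d = 0"
      using minimal[of "a mod d"] d(1) by auto
    then show ?thesis by auto
  qed
qed

lemma primitive_division_point_unique:
  assumes "primitive_division_point \<tau> d z" "primitive_division_point \<tau> e z"
  shows "d = e"
proof (rule dvd_antisym)
  show "d dvd e"
    using assms(2) primitive_division_point_dvd_iff[OF assms(1), of e] by (simp add: primitive_division_point_def)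
  show "e dvd d"
    using assms(1) primitive_division_point_dvd_iff[OF assms(2), of d] by (simp add: primitive_division_point_def)
qed

lemma ex_primitive_division_point:
  assumes "a > 0" "of_nat a * z \<in> period_lattice \<tau>"
  obtains d where "primitive_division_point \<tau> d z"
proof -
  define d where "d = (LEAST d. d > 0 \<and> of_nat d * z \<in> period_lattice \<tau>)"
  have "d > 0 \<and> of_nat d * z \<in> period_lattice \<tau>"
    unfolding d_def by (rule LeastI[of _ a]) (use assms in auto)
  moreover have "of_nat e * z \<notin> period_lattice \<tau>" if "0 < e" "e < d" for e
    using not_less_Least[of e] that unfolding d_def by blast
  ultimately have "primitive_division_point \<tau> d z"
    by (simp add: primitive_division_point_def)
  then show ?thesis by (rule that)
qed

text \<open>These points at \<tau> = i serve as test points from which each coefficient of a divisor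
  can be read off.\<close>

lemma primitive_division_point_inverse:
  assumes "d > 0"
  shows "primitive_division_point \<i> d (1 / of_nat d)"
proof -
  have "of_nat d * (1 / of_nat d) \<in> period_lattice \<i>"
    unfolding period_lattice_iff using assms by (intro exI[of _ 0] exI[of _ 1]) auto
  moreover have "of_nat e * (1 / of_nat d) \<notin> period_lattice \<i>" if e: "0 < e" "e < d" for e
  proof
    assume "of_nat e * (1 / of_nat d) \<in> period_lattice \<i>"
    then obtain m n :: int where mn: "of_nat e * (1 / of_nat d) = of_int m * \<i> + of_int n"
      unfolding period_lattice_iff by blast
    have "complex_of_real (real e / real d) = of_int m * \<i> + of_int n"
      using mn by simp
    from arg_cong[OF this, of Re] have "real e / real d = of_int n"
      by simp
    then have "0 < real_of_int n" "real_of_int n < 1"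
      using e by (auto simp flip: \<open>real e / real d = of_int n\<close>)
    then show False by simp
  qed
  ultimately show ?thesis
    using assms by (simp add: primitive_division_point_def)
qed

lemma sum_primitive_division_point:
  fixes D :: "nat \<Rightarrow>\<^sub>0 int"
  assumes "primitive_division_point \<tau> d z"
  shows "(\<Sum>a\<in>Poly_Mapping.keys D. Poly_Mapping.lookup D a * (if primitive_division_point \<tau> a z then 1 else 0))
    = Poly_Mapping.lookup D d"
proof -
  have *: "primitive_division_point \<tau> a z \<longleftrightarrow> a = d" for a
    using assms primitive_division_point_unique[OF _ assms] by metis
  have "(\<Sum>a\<in>Poly_Mapping.keys D. Poly_Mapping.lookup D a * (if primitive_division_point \<tau> a z then 1 else 0))
      = (\<Sum>a\<in>Poly_Mapping.keys D. if a = d then Poly_Mapping.lookup D d else 0)"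
    unfolding * by (intro sum.cong) auto
  also have "\<dots> = Poly_Mapping.lookup D d"
    using in_keys_iff[of d D] by (simp only: sum.delta' sum.delta finite_keys) auto
  finally show ?thesis .
qed

text \<open>The order at 1/d over \<tau> = i recovers the coefficient of each d > 0. There are no
  primitive 0-division points, so index 0 is settled by the condition on keys. This makes the
  description in \<open>Div\<close> definite.\<close>

lemma has_Div_unique:
  assumes "has_Div f D" "has_Div f D'" "Poly_Mapping.keys D \<subseteq> {0<..}" "Poly_Mapping.keys D' \<subseteq> {0<..}"
  shows "D = D'"
proof (rule poly_mapping_eqI)
  fix d
  show "Poly_Mapping.lookup D d = Poly_Mapping.lookup D' d"
  proof (cases "d > 0")
    case True
    have "zorder (f \<i>) (1 / of_nat d) = Poly_Mapping.lookup D d" if "has_Div f D" for D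
      unfolding sum_primitive_division_point[OF primitive_division_point_inverse[OF True], symmetric]
      using that by (auto simp: has_Div_def upper_half_plane_def)
    with assms(1,2) show ?thesis
      by metis
  next
    case False
    with assms(3,4) show ?thesis
      by (metis greaterThan_iff in_keys_iff subsetD)
  qed
qed

lemma Div_eqI: "has_Div f D \<Longrightarrow> Poly_Mapping.keys D \<subseteq> {0<..} \<Longrightarrow> Div f = D"
  unfolding Div_def by (rule the_equality) (auto intro: has_Div_unique)

section \<open>Equality of meromorphic functions off isolated points\<close>

text \<open>Agreement on punctured neighbourhoods ignores default values such as x / 0 = 0. It is
  the relation that \<open>mero_rep\<close> turns into equality.\<close>

definition mero_eq :: "(complex \<Rightarrow> complex \<Rightarrow> complex) \<Rightarrow> (complex \<Rightarrow> complex \<Rightarrow> complex) \<Rightarrow> bool"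
  where "mero_eq F G \<longleftrightarrow> (\<forall>\<tau>\<in>upper_half_plane. \<forall>z. \<forall>\<^sub>F w in at z. F \<tau> w = G \<tau> w)"

lemma mero_eq_refl [simp]: "mero_eq F F"
  by (simp add: mero_eq_def)

lemma mero_eq_sym: "mero_eq F G \<Longrightarrow> mero_eq G F"
  by (simp add: mero_eq_def eq_commute)

lemma mero_eq_trans [trans]:
  assumes "mero_eq F G" "mero_eq G H"
  shows "mero_eq F H"
  unfolding mero_eq_def
proof (intro ballI allI)
  fix \<tau> z :: complex assume "\<tau> \<in> upper_half_plane"
  with assms have "\<forall>\<^sub>F w in at z. F \<tau> w = G \<tau> w" "\<forall>\<^sub>F w in at z. G \<tau> w = H \<tau> w"
    by (auto simp: mero_eq_def)
  then show "\<forall>\<^sub>F w in at z. F \<tau> w = H \<tau> w"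
    by eventually_elim simp
qed

lemma mero_eq_cong2:
  assumes "mero_eq F F'" "mero_eq G G'"
  shows "mero_eq (\<lambda>\<tau> z. h (F \<tau> z) (G \<tau> z)) (\<lambda>\<tau> z. h (F' \<tau> z) (G' \<tau> z))"
  unfolding mero_eq_def
proof (intro ballI allI)
  fix \<tau> z :: complex assume "\<tau> \<in> upper_half_plane"
  with assms have "\<forall>\<^sub>F w in at z. F \<tau> w = F' \<tau> w" "\<forall>\<^sub>F w in at z. G \<tau> w = G' \<tau> w"
    by (auto simp: mero_eq_def)
  then show "\<forall>\<^sub>F w in at z. h (F \<tau> w) (G \<tau> w) = h (F' \<tau> w) (G' \<tau> w)"
    by eventually_elim simp
qed

lemmas mero_eq_mult = mero_eq_cong2[where h = "(*)"]
lemmas mero_eq_divide = mero_eq_cong2[where h = "(/)"]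

lemma mero_eq_power_int:
  "mero_eq F F' \<Longrightarrow> mero_eq (\<lambda>\<tau> z. F \<tau> z powi k) (\<lambda>\<tau> z. F' \<tau> z powi k)"
  using mero_eq_cong2[of F F' F F' "\<lambda>x _. x powi k"] by simp

lemma mero_eq_prod:
  assumes "\<And>a. a \<in> A \<Longrightarrow> mero_eq (F a) (G a)"
  shows "mero_eq (\<lambda>\<tau> z. \<Prod>a\<in>A. F a \<tau> z) (\<lambda>\<tau> z. \<Prod>a\<in>A. G a \<tau> z)"
  using assms
proof (induction A rule: infinite_finite_induct)
  case (insert a A)
  then show ?case
    using mero_eq_mult[of "F a" "G a"] by simp
qed simp_all

lemma mero_rep_cong: "mero_eq F G \<Longrightarrow> mero_rep F = mero_rep G"
  unfolding mero_eq_def mero_rep_def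
  by (intro restrict_ext ext remove_sings_cong) auto

text \<open>Singularities of a meromorphic function are isolated, so passing to the representative
  changes nothing in a small punctured neighbourhood.\<close>

lemma mero_eq_mero_rep:
  assumes "\<And>\<tau>. \<tau> \<in> upper_half_plane \<Longrightarrow> F \<tau> meromorphic_on UNIV"
  shows "mero_eq (mero_rep F) F"
  unfolding mero_eq_def
proof (intro ballI allI)
  fix \<tau> z assume \<tau>: "\<tau> \<in> upper_half_plane"
  have "F \<tau> meromorphic_on {z}"
    using assms[OF \<tau>] by (rule meromorphic_on_subset) simp
  then have "\<forall>\<^sub>F w in at z. remove_sings (F \<tau>) w = F \<tau> w"
    by (intro eventually_remove_sings_eq_at meromorphic_on_isolated_singularity)
  then show "\<forall>\<^sub>F w in at z. mero_rep F \<tau> w = F \<tau> w"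
    using \<tau> by (simp add: mero_rep_def)
qed

section \<open>Calculus of products of theta powers\<close>

lemma power_int_prod:
  fixes f :: "'a \<Rightarrow> 'b :: field"
  shows "(\<Prod>a\<in>A. f a) powi k = (\<Prod>a\<in>A. f a powi k)"
  by (induction A rule: infinite_finite_induct) (simp_all add: power_int_mult_distrib)

definition theta_power :: "(nat \<Rightarrow>\<^sub>0 int) \<Rightarrow> complex \<Rightarrow> complex \<Rightarrow> complex"
  where "theta_power m \<tau> z =
    (\<Prod>a\<in>Poly_Mapping.keys m. theta_scaled (int a) \<tau> z powi Poly_Mapping.lookup m a)"

lemma theta_power_superset:
  "finite A \<Longrightarrow> Poly_Mapping.keys m \<subseteq> A \<Longrightarrow>
    theta_power m \<tau> z = (\<Prod>a\<in>A. theta_scaled (int a) \<tau> z powi Poly_Mapping.lookup m a)"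
  unfolding theta_power_def by (rule prod.mono_neutral_left) (auto simp: in_keys_iff)

lemma theta_power_0 [simp]: "theta_power 0 \<tau> z = 1"
  by (simp add: theta_power_def)

lemma theta_power_frag_of [simp]: "theta_power (frag_of a) \<tau> z = theta_scaled (int a) \<tau> z"
  by (simp add: theta_power_def)

lemma meromorphic_theta_power:
  assumes "\<tau> \<in> upper_half_plane"
  shows "theta_power m \<tau> meromorphic_on A"
proof -
  have "theta_scaled a \<tau> meromorphic_on A" for a
    by (intro analytic_on_imp_meromorphic_on analytic_theta_scaled assms)
  then show ?thesis
    unfolding theta_power_def[abs_def] by (intro meromorphic_intros)
qed

lemma eventually_theta_power_nonzero:
  assumes "\<tau> \<in> upper_half_plane" "Poly_Mapping.keys m \<subseteq> {0<..}"
  shows "\<forall>\<^sub>F w in at z. theta_power m \<tau> w \<noteq> 0"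
proof -
  have "\<forall>\<^sub>F w in at z. \<forall>a\<in>Poly_Mapping.keys m. theta_scaled (int a) \<tau> w \<noteq> 0"
    using assms by (intro eventually_ball_finite finite_keys ballI eventually_theta_scaled_nonzero) auto
  then show ?thesis
    by eventually_elim (simp add: theta_power_def)
qed

text \<open>The law x^(k - l) = x^k / x^l can fail at x = 0, so the identity is claimed only off the
  isolated zeros. Differences come first because they match \<open>frag_induction\<close>.\<close>

lemma theta_power_diff:
  assumes "Poly_Mapping.keys m \<subseteq> {0<..}" "Poly_Mapping.keys m' \<subseteq> {0<..}"
  shows "mero_eq (theta_power (m - m')) (\<lambda>\<tau> z. theta_power m \<tau> z / theta_power m' \<tau> z)"
  unfolding mero_eq_def
proof (intro ballI allI)
  fix \<tau> z assume \<tau>: "\<tau> \<in> upper_half_plane"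
  define A where "A = Poly_Mapping.keys m \<union> Poly_Mapping.keys m'"
  have A: "finite A" "Poly_Mapping.keys m \<subseteq> A" "Poly_Mapping.keys m' \<subseteq> A" "Poly_Mapping.keys (m - m') \<subseteq> A"
    using keys_diff[of m m'] by (auto simp: A_def)
  have "\<forall>\<^sub>F w in at z. \<forall>a\<in>A. theta_scaled (int a) \<tau> w \<noteq> 0"
    using assms \<tau> A(1)
    by (intro eventually_ball_finite ballI eventually_theta_scaled_nonzero) (auto simp: A_def)
  then show "\<forall>\<^sub>F w in at z. theta_power (m - m') \<tau> w = theta_power m \<tau> w / theta_power m' \<tau> w"
  proof eventually_elim
    case (elim w)
    then show ?case
      unfolding theta_power_superset[OF A(1,2)] theta_power_superset[OF A(1,3)] theta_power_superset[OF A(1,4)]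
      by (simp add: lookup_minus power_int_diff prod_dividef[symmetric])
  qed
qed

lemma theta_power_uminus:
  assumes "Poly_Mapping.keys m \<subseteq> {0<..}"
  shows "mero_eq (theta_power (- m)) (\<lambda>\<tau> z. 1 / theta_power m \<tau> z)"
  using theta_power_diff[of 0 m] assms by simp

lemma theta_power_add:
  assumes "Poly_Mapping.keys m \<subseteq> {0<..}" "Poly_Mapping.keys m' \<subseteq> {0<..}"
  shows "mero_eq (theta_power (m + m')) (\<lambda>\<tau> z. theta_power m \<tau> z * theta_power m' \<tau> z)"
proof -
  have "mero_eq (theta_power (m - (- m'))) (\<lambda>\<tau> z. theta_power m \<tau> z / theta_power (- m') \<tau> z)"
    using assms by (intro theta_power_diff) auto
  also have "mero_eq \<dots> (\<lambda>\<tau> z. theta_power m \<tau> z / (1 / theta_power m' \<tau> z))"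
    using assms by (intro mero_eq_divide theta_power_uminus) auto
  finally show ?thesis by simp
qed

text \<open>Unlike the additive law, (x^k)^l = x^(k l) holds at x = 0 too, so this is a pointwise
  identity. The product is taken over the keys of m since k = 0 loses keys.\<close>

lemma theta_power_cmul: "theta_power (frag_cmul k m) \<tau> z = theta_power m \<tau> z powi k"
proof -
  have "theta_power (frag_cmul k m) \<tau> z =
      (\<Prod>a\<in>Poly_Mapping.keys m. theta_scaled (int a) \<tau> z powi Poly_Mapping.lookup (frag_cmul k m) a)"
    by (rule theta_power_superset) (auto intro: keys_cmul)
  then show ?thesis
    by (simp add: theta_power_def power_int_mult mult.commute[of k] power_int_prod)
qed

lemma theta_power_sum:
  assumes "finite A" "\<And>a. a \<in> A \<Longrightarrow> Poly_Mapping.keys (f a) \<subseteq> {0<..}"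
  shows "mero_eq (theta_power (sum f A)) (\<lambda>\<tau> z. \<Prod>a\<in>A. theta_power (f a) \<tau> z)"
  using assms
proof (induction A rule: finite_induct)
  case (insert a A)
  have "Poly_Mapping.keys (sum f A) \<subseteq> {0<..}"
    using keys_sum[of f A] insert.prems by blast
  then have "mero_eq (theta_power (f a + sum f A)) (\<lambda>\<tau> z. theta_power (f a) \<tau> z * theta_power (sum f A) \<tau> z)"
    using insert.prems by (intro theta_power_add) auto
  also have "mero_eq \<dots> (\<lambda>\<tau> z. theta_power (f a) \<tau> z * (\<Prod>a\<in>A. theta_power (f a) \<tau> z))"
    using insert by (intro mero_eq_mult) auto
  finally show ?case
    using insert by simp
qed (simp add: mero_eq_def)

section \<open>Normal forms of theta quotients and their divisors\<close>

text \<open>The normal form of a theta quotient. It reduces the group law to addition and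
  multiplication of the data \<epsilon>, n, m.\<close>

definition theta_monomial :: "complex \<Rightarrow> int \<Rightarrow> (nat \<Rightarrow>\<^sub>0 int) \<Rightarrow> complex \<Rightarrow> complex \<Rightarrow> complex"
  where "theta_monomial \<epsilon> n m = mero_rep (\<lambda>\<tau> z. \<epsilon> * dedekind_eta \<tau> powi n * theta_power m \<tau> z)"

lemma mero_eq_theta_monomial:
  "mero_eq (theta_monomial \<epsilon> n m) (\<lambda>\<tau> z. \<epsilon> * dedekind_eta \<tau> powi n * theta_power m \<tau> z)"
  unfolding theta_monomial_def
  by (intro mero_eq_mero_rep meromorphic_intros meromorphic_theta_power)

lemma theta_monomial_mult:
  assumes "Poly_Mapping.keys m \<subseteq> {0<..}" "Poly_Mapping.keys m' \<subseteq> {0<..}"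
  shows "mero_rep (\<lambda>\<tau> z. theta_monomial \<epsilon> n m \<tau> z * theta_monomial \<epsilon>' n' m' \<tau> z) =
    theta_monomial (\<epsilon> * \<epsilon>') (n + n') (m + m')"
proof -
  have "mero_eq (\<lambda>\<tau> z. theta_monomial \<epsilon> n m \<tau> z * theta_monomial \<epsilon>' n' m' \<tau> z)
      (\<lambda>\<tau> z. (\<epsilon> * dedekind_eta \<tau> powi n * theta_power m \<tau> z) *
        (\<epsilon>' * dedekind_eta \<tau> powi n' * theta_power m' \<tau> z))"
    by (intro mero_eq_mult mero_eq_theta_monomial)
  also have "mero_eq \<dots> (\<lambda>\<tau> z. (\<epsilon> * \<epsilon>' * dedekind_eta \<tau> powi (n + n')) * (theta_power m \<tau> z * theta_power m' \<tau> z))"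
    by (auto simp: mero_eq_def power_int_add dedekind_eta_nonzero mult_ac)
  also have "mero_eq \<dots> (\<lambda>\<tau> z. (\<epsilon> * \<epsilon>' * dedekind_eta \<tau> powi (n + n')) * theta_power (m + m') \<tau> z)"
    by (intro mero_eq_mult mero_eq_refl mero_eq_sym[OF theta_power_add] assms)
  finally show ?thesis
    unfolding theta_monomial_def[of "\<epsilon> * \<epsilon>'"] by (rule mero_rep_cong)
qed

text \<open>For fixed \<tau> the factor \<epsilon> \<eta>^n is a nonzero constant, and orders add
  over the remaining product.\<close>

lemma zorder_theta_monomial:
  assumes "\<tau> \<in> upper_half_plane" "Poly_Mapping.keys m \<subseteq> {0<..}" "\<epsilon> \<noteq> 0"
  shows "zorder (theta_monomial \<epsilon> n m \<tau>) z = (\<Sum>a\<in>Poly_Mapping.keys m.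
    Poly_Mapping.lookup m a * (if of_nat a * z \<in> period_lattice \<tau> then 1 else 0))"
proof -
  note \<tau> = assms(1)
  have mero: "theta_scaled a \<tau> meromorphic_on {z}" for a
    by (intro analytic_on_imp_meromorphic_on analytic_theta_scaled \<tau>)
  have "zorder (theta_monomial \<epsilon> n m \<tau>) z = zorder (\<lambda>w. \<epsilon> * dedekind_eta \<tau> powi n * theta_power m \<tau> w) z"
    using mero_eq_theta_monomial \<tau> by (intro zorder_cong) (auto simp: mero_eq_def)
  also have "\<dots> = zorder (theta_power m \<tau>) z"
    using assms dedekind_eta_nonzero[OF \<tau>] by (intro zorder_cmult) auto
  also have "\<dots> = (\<Sum>a\<in>Poly_Mapping.keys m. zorder (\<lambda>w. theta_scaled (int a) \<tau> w powi Poly_Mapping.lookup m a) z)"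
    unfolding theta_power_def[abs_def]
    using eventually_theta_power_nonzero[OF \<tau> assms(2)] mero
    by (intro zorder_prod meromorphic_intros) (auto simp: theta_power_def)
  also have "\<dots> = (\<Sum>a\<in>Poly_Mapping.keys m.
    Poly_Mapping.lookup m a * (if of_nat a * z \<in> period_lattice \<tau> then 1 else 0))"
  proof (rule sum.cong)
    fix a assume "a \<in> Poly_Mapping.keys m"
    then have "int a \<noteq> 0"
      using assms(2) by auto
    then show "zorder (\<lambda>w. theta_scaled (int a) \<tau> w powi Poly_Mapping.lookup m a) z =
        Poly_Mapping.lookup m a * (if of_nat a * z \<in> period_lattice \<tau> then 1 else 0)"
      using zorder_theta_scaled[OF \<tau>] eventually_theta_scaled_nonzero[OF \<tau>]
      by (subst zorder_power_int[OF mero]) (auto intro!: eventually_frequently)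
  qed simp
  finally show ?thesis .
qed

lemma has_Div_theta_monomial:
  assumes "Poly_Mapping.keys m \<subseteq> {0<..}" "\<epsilon> \<noteq> 0"
  shows "has_Div (theta_monomial \<epsilon> n m) (theta_divisor m)"
  unfolding has_Div_def
proof (intro ballI allI)
  fix \<tau> z assume \<tau>: "\<tau> \<in> upper_half_plane"
  let ?P = "\<lambda>a. primitive_division_point \<tau> a z"
  let ?ord = "\<Sum>a\<in>Poly_Mapping.keys m. Poly_Mapping.lookup m a * (if of_nat a * z \<in> period_lattice \<tau> then 1 else 0)"
  have "?ord = (\<Sum>a\<in>Poly_Mapping.keys (theta_divisor m). Poly_Mapping.lookup (theta_divisor m) a * (if ?P a then 1 else 0))"
  \<comment> \<open>If z has exact order d, the index a contributes precisely when d divides a,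
    which is the coefficient of (d) in \<open>divisor_frag a\<close>. If z is not a torsion point,
    both sums vanish.\<close>
  proof (cases "\<exists>d. ?P d")
    case True
    then obtain d where d: "?P d" ..
    have "Poly_Mapping.lookup (theta_divisor m) d =
        (\<Sum>a\<in>Poly_Mapping.keys m. Poly_Mapping.lookup m a * Poly_Mapping.lookup (divisor_frag a) d)"
      by (simp add: theta_divisor_def frag_extend_def lookup_sum)
    also have "\<dots> = ?ord"
      using assms(1) by (intro sum.cong) (auto simp: lookup_divisor_frag primitive_division_point_dvd_iff[OF d])
    finally show ?thesis
      unfolding sum_primitive_division_point[OF d] by (rule sym)
  next
    case False
    then have "of_nat a * z \<notin> period_lattice \<tau>" if "a \<in> Poly_Mapping.keys m" for a
      using ex_primitive_division_point[of a z \<tau>] that assms(1) by auto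
    with False show ?thesis by simp
  qed
  then show "zorder (theta_monomial \<epsilon> n m \<tau>) z =
      (\<Sum>a\<in>Poly_Mapping.keys (theta_divisor m). Poly_Mapping.lookup (theta_divisor m) a * (if ?P a then 1 else 0))"
    using zorder_theta_monomial[OF \<tau> assms] by simp
qed

lemma Div_theta_monomial:
  "Poly_Mapping.keys m \<subseteq> {0<..} \<Longrightarrow> \<epsilon> \<noteq> 0 \<Longrightarrow> Div (theta_monomial \<epsilon> n m) = theta_divisor m"
  by (intro Div_eqI has_Div_theta_monomial keys_theta_divisor)

lemma mero_eq_S_prim:
  assumes "a > 0"
  shows "mero_eq (S_prim a) (theta_power (moebius_frag a))"
proof -
  have fin: "finite {d. d dvd a}"
    using assms by simp
  have sub: "Poly_Mapping.keys (moebius_frag a) \<subseteq> {d. d dvd a}"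
    using assms by (auto simp: in_keys_iff lookup_moebius_frag split: if_splits)
  have eq: "(\<lambda>\<tau> z. \<Prod>d | d dvd a. theta_scaled (int d) \<tau> z powi moebius (a div d)) = theta_power (moebius_frag a)"
    unfolding theta_power_superset[OF fin sub, abs_def]
    by (intro ext prod.cong) (auto simp: lookup_moebius_frag[OF assms])
  show ?thesis
    unfolding S_prim_def eq by (intro mero_eq_mero_rep meromorphic_theta_power)
qed

text \<open>The representatives inside \<open>S_Div\<close> are replaced by plain products up to
  \<open>mero_eq\<close>, which the outer \<open>mero_rep\<close> cannot distinguish.\<close>

lemma S_Div_eq_theta_monomial:
  assumes "Poly_Mapping.keys D \<subseteq> {0<..}"
  shows "S_Div D = theta_monomial 1 0 (S_exponents D)"
proof -
  have "mero_eq (\<lambda>\<tau> z. \<Prod>a\<in>Poly_Mapping.keys D. S_prim a \<tau> z powi Poly_Mapping.lookup D a)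
      (\<lambda>\<tau> z. \<Prod>a\<in>Poly_Mapping.keys D. theta_power (moebius_frag a) \<tau> z powi Poly_Mapping.lookup D a)"
    using assms by (intro mero_eq_prod mero_eq_power_int mero_eq_S_prim) auto
  also have "mero_eq \<dots> (theta_power (S_exponents D))"
    unfolding S_exponents_def frag_extend_def theta_power_cmul[symmetric]
    using assms keys_moebius_frag
    by (intro mero_eq_sym[OF theta_power_sum] finite_keys order_trans[OF keys_cmul]) auto
  finally show ?thesis
    unfolding S_Div_def theta_monomial_def by (simp, rule mero_rep_cong)
qed

subsection \<open>The exact sequence\<close>

text \<open>Pairs an index set with the constants it produces, so that \<open>TQ_pos\<close> and
  \<open>TQ\<close> are treated together.\<close>

definition sign_group :: "int set \<Rightarrow> complex set \<Rightarrow> bool"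
  where "sign_group I E \<longleftrightarrow> I = {a. a > 0} \<and> E = {1} \<or> I = {a. a \<noteq> 0} \<and> E = {1, - 1}"

lemma sign_group_one: "sign_group I E \<Longrightarrow> 1 \<in> E"
  and sign_group_mult: "sign_group I E \<Longrightarrow> \<epsilon> \<in> E \<Longrightarrow> \<delta> \<in> E \<Longrightarrow> \<epsilon> * \<delta> \<in> E"
  and sign_group_square: "sign_group I E \<Longrightarrow> \<epsilon> \<in> E \<Longrightarrow> \<epsilon> * \<epsilon> = 1"
  and sign_group_nonzero: "sign_group I E \<Longrightarrow> \<epsilon> \<in> E \<Longrightarrow> \<epsilon> \<noteq> 0"
  and sign_group_pos: "sign_group I E \<Longrightarrow> {a. a > 0} \<subseteq> I"
  and sign_group_minus_one: "sign_group I E \<Longrightarrow> \<epsilon> \<in> E \<Longrightarrow> \<epsilon> \<noteq> 1 \<Longrightarrow> \<epsilon> = - 1 \<and> - 1 \<in> I"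
  by (auto simp: sign_group_def)

lemma theta_scaled_sign:
  assumes "sign_group I E" "a \<in> I"
  obtains \<epsilon> where "\<epsilon> \<in> E" "\<And>\<tau> z. theta_scaled a \<tau> z = \<epsilon> * theta_scaled (int (nat \<bar>a\<bar>)) \<tau> z" "nat \<bar>a\<bar> > 0"
proof (cases "a > 0")
  case True
  with assms(1) show ?thesis
    by (intro that[of 1]) (auto simp: sign_group_one)
next
  case False
  then show ?thesis
    using assms theta_scaled_uminus[of "- a"]
    by (intro that[of "- 1"]) (auto simp: sign_group_def)
qed

lemma keys_add_subset: "Poly_Mapping.keys m \<subseteq> S \<Longrightarrow> Poly_Mapping.keys m' \<subseteq> S \<Longrightarrow> Poly_Mapping.keys (m + m') \<subseteq> S"
  using keys_add[of m m'] by blast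

text \<open>Each index is replaced by its absolute value at the cost of a sign in E, and repeated
  indices are collected into exponents.\<close>

lemma theta_list_as_power:
  assumes "sign_group I E" "set as \<subseteq> I"
  obtains \<epsilon> m where "\<epsilon> \<in> E" "Poly_Mapping.keys m \<subseteq> {0<..}"
    "mero_eq (\<lambda>\<tau> z. \<Prod>a\<leftarrow>as. theta_scaled a \<tau> z) (\<lambda>\<tau> z. \<epsilon> * theta_power m \<tau> z)"
  using assms(2)
proof (induction as arbitrary: thesis)
  case Nil
  show ?case
    by (rule Nil(1)[of 1 0]) (auto simp: sign_group_one[OF assms(1)])
next
  case (Cons a as)
  obtain \<epsilon> m where IH: "\<epsilon> \<in> E" "Poly_Mapping.keys m \<subseteq> {0<..}"
    "mero_eq (\<lambda>\<tau> z. \<Prod>a\<leftarrow>as. theta_scaled a \<tau> z) (\<lambda>\<tau> z. \<epsilon> * theta_power m \<tau> z)"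
    using Cons.IH Cons.prems(2) by auto
  obtain \<delta> where \<delta>: "\<delta> \<in> E" "\<And>\<tau> z. theta_scaled a \<tau> z = \<delta> * theta_scaled (int (nat \<bar>a\<bar>)) \<tau> z" "nat \<bar>a\<bar> > 0"
    using theta_scaled_sign[OF assms(1), of a] Cons.prems(2) by auto
  let ?f = "frag_of (nat \<bar>a\<bar>) :: nat \<Rightarrow>\<^sub>0 int"
  have keys: "Poly_Mapping.keys ?f \<subseteq> {0<..}"
    using \<delta>(3) by simp
  have "mero_eq (\<lambda>\<tau> z. theta_scaled a \<tau> z * (\<Prod>a\<leftarrow>as. theta_scaled a \<tau> z))
      (\<lambda>\<tau> z. theta_scaled a \<tau> z * (\<epsilon> * theta_power m \<tau> z))"
    by (intro mero_eq_mult mero_eq_refl IH(3))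
  also have "(\<lambda>\<tau> z. theta_scaled a \<tau> z * (\<epsilon> * theta_power m \<tau> z)) =
      (\<lambda>\<tau> z. (\<delta> * \<epsilon>) * (theta_power ?f \<tau> z * theta_power m \<tau> z))"
    by (intro ext) (simp add: \<delta>(2)[of _ _])
  also have "mero_eq \<dots> (\<lambda>\<tau> z. (\<delta> * \<epsilon>) * theta_power (?f + m) \<tau> z)"
    by (intro mero_eq_mult mero_eq_refl mero_eq_sym[OF theta_power_add] keys IH(2))
  finally have "mero_eq (\<lambda>\<tau> z. \<Prod>a\<leftarrow>a # as. theta_scaled a \<tau> z) (\<lambda>\<tau> z. (\<delta> * \<epsilon>) * theta_power (?f + m) \<tau> z)"
    by simp
  then show ?case
    by (rule Cons.prems(1)[OF sign_group_mult[OF assms(1) \<delta>(1) IH(1)] keys_add_subset[OF keys IH(2)]])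
qed

text \<open>Subtracting exponent vectors divides the quotients: each numerator list is joined with
  the other denominator list.\<close>

lemma theta_power_as_quotient:
  assumes "Poly_Mapping.keys m \<subseteq> {0<..}"
  obtains as bs where "set as \<subseteq> {a. a > 0}" "set bs \<subseteq> {a. a > 0}"
    "mero_eq (theta_power m) (\<lambda>\<tau> z. (\<Prod>a\<leftarrow>as. theta_scaled a \<tau> z) / (\<Prod>b\<leftarrow>bs. theta_scaled b \<tau> z))"
proof -
  let ?q = "\<lambda>as bs \<tau> z. (\<Prod>a\<leftarrow>as. theta_scaled a \<tau> z) / (\<Prod>b\<leftarrow>bs. theta_scaled b \<tau> z)"
  have "Poly_Mapping.keys m \<subseteq> {0<..} \<and> (\<exists>as bs. set as \<subseteq> {a. a > 0} \<and> set bs \<subseteq> {a. a > 0} \<and>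
      mero_eq (theta_power m) (?q as bs))"
    using assms
  proof (induction m rule: frag_induction)
    case zero
    show ?case
      by (auto intro!: exI[of _ "[]"] simp: mero_eq_def)
  next
    case (one x)
    have "theta_power (frag_of x) = ?q [int x] []"
      by (intro ext) simp
    then have "mero_eq (theta_power (frag_of x)) (?q [int x] [])"
      by simp
    moreover have "set [int x] \<subseteq> {a. a > 0}" "set [] \<subseteq> {a::int. a > 0}"
      using one by auto
    moreover have "Poly_Mapping.keys (frag_of x :: nat \<Rightarrow>\<^sub>0 int) \<subseteq> {0<..}"
      using one by auto
    ultimately show ?case by blast
  next
    case (diff m m')
    then obtain as bs as' bs' where *:
      "set as \<subseteq> {a. a > 0}" "set bs \<subseteq> {a. a > 0}" "mero_eq (theta_power m) (?q as bs)"
      "set as' \<subseteq> {a. a > 0}" "set bs' \<subseteq> {a. a > 0}" "mero_eq (theta_power m') (?q as' bs')"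
      by blast
    have keys: "Poly_Mapping.keys m \<subseteq> {0<..}" "Poly_Mapping.keys m' \<subseteq> {0<..}"
      using diff by auto
    have "mero_eq (theta_power (m - m')) (\<lambda>\<tau> z. theta_power m \<tau> z / theta_power m' \<tau> z)"
      by (rule theta_power_diff[OF keys])
    also have "mero_eq \<dots> (\<lambda>\<tau> z. ?q as bs \<tau> z / ?q as' bs' \<tau> z)"
      by (rule mero_eq_divide[OF *(3,6)])
    also have "\<dots> = ?q (as @ bs') (bs @ as')"
      by simp
    finally have "mero_eq (theta_power (m - m')) (?q (as @ bs') (bs @ as'))" .
    moreover have "Poly_Mapping.keys (m - m') \<subseteq> {0<..}"
      using keys_diff[of m m'] keys by blast
    moreover have "set (as @ bs') \<subseteq> {a. a > 0}" "set (bs @ as') \<subseteq> {a. a > 0}"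
      using * by auto
    ultimately show ?case by blast
  qed
  then show ?thesis
    using that by blast
qed

lemma theta_quotients_eq:
  assumes "sign_group I E"
  shows "theta_quotients I = {theta_monomial \<epsilon> n m | \<epsilon> n m. \<epsilon> \<in> E \<and> Poly_Mapping.keys m \<subseteq> {0<..}}"
proof (intro equalityI subsetI)
  fix f assume "f \<in> theta_quotients I"
  then obtain n as bs where f: "set as \<subseteq> I" "set bs \<subseteq> I"
    "f = mero_rep (\<lambda>\<tau> z. dedekind_eta \<tau> powi n
        * (\<Prod>a\<leftarrow>as. theta_scaled a \<tau> z) / (\<Prod>b\<leftarrow>bs. theta_scaled b \<tau> z))"
    unfolding theta_quotients_def by blast
  obtain \<epsilon> m where m: "\<epsilon> \<in> E" "Poly_Mapping.keys m \<subseteq> {0<..}"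
    "mero_eq (\<lambda>\<tau> z. \<Prod>a\<leftarrow>as. theta_scaled a \<tau> z) (\<lambda>\<tau> z. \<epsilon> * theta_power m \<tau> z)"
    using theta_list_as_power[OF assms f(1)] .
  obtain \<delta> m' where m': "\<delta> \<in> E" "Poly_Mapping.keys m' \<subseteq> {0<..}"
    "mero_eq (\<lambda>\<tau> z. \<Prod>a\<leftarrow>bs. theta_scaled a \<tau> z) (\<lambda>\<tau> z. \<delta> * theta_power m' \<tau> z)"
    using theta_list_as_power[OF assms f(2)] .
  \<comment> \<open>Dividing by the sign is multiplying by it, because its square is 1.\<close>
  have \<delta>: "x / (\<delta> * y) = \<delta> * x / y" for x y
    using inverse_unique[OF sign_group_square[OF assms m'(1)]] by (simp add: divide_inverse mult_ac)
  have "mero_eq (\<lambda>\<tau> z. dedekind_eta \<tau> powi n * (\<Prod>a\<leftarrow>as. theta_scaled a \<tau> z) / (\<Prod>b\<leftarrow>bs. theta_scaled b \<tau> z))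
     (\<lambda>\<tau> z. dedekind_eta \<tau> powi n * (\<epsilon> * theta_power m \<tau> z) / (\<delta> * theta_power m' \<tau> z))"
    by (intro mero_eq_divide mero_eq_mult mero_eq_refl m(3) m'(3))
  also have "\<dots> = (\<lambda>\<tau> z. (\<epsilon> * \<delta>) * dedekind_eta \<tau> powi n * (theta_power m \<tau> z / theta_power m' \<tau> z))"
    by (intro ext) (simp add: \<delta> mult_ac)
  also have "mero_eq \<dots> (\<lambda>\<tau> z. (\<epsilon> * \<delta>) * dedekind_eta \<tau> powi n * theta_power (m - m') \<tau> z)"
    by (intro mero_eq_mult mero_eq_refl mero_eq_sym[OF theta_power_diff] m(2) m'(2))
  finally have "f = theta_monomial (\<epsilon> * \<delta>) n (m - m')"
    unfolding f(3) theta_monomial_def by (rule mero_rep_cong)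
  moreover have "Poly_Mapping.keys (m - m') \<subseteq> {0<..}"
    using keys_diff[of m m'] m(2) m'(2) by blast
  ultimately show "f \<in> {theta_monomial \<epsilon> n m | \<epsilon> n m. \<epsilon> \<in> E \<and> Poly_Mapping.keys m \<subseteq> {0<..}}"
    using sign_group_mult[OF assms m(1) m'(1)] by blast
next
  fix f assume "f \<in> {theta_monomial \<epsilon> n m | \<epsilon> n m. \<epsilon> \<in> E \<and> Poly_Mapping.keys m \<subseteq> {0<..}}"
  then obtain \<epsilon> n m where f: "f = theta_monomial \<epsilon> n m" "\<epsilon> \<in> E" "Poly_Mapping.keys m \<subseteq> {0<..}"
    by blast
  obtain as bs where q: "set as \<subseteq> {a. a > 0}" "set bs \<subseteq> {a. a > 0}"
    "mero_eq (theta_power m) (\<lambda>\<tau> z. (\<Prod>a\<leftarrow>as. theta_scaled a \<tau> z) / (\<Prod>b\<leftarrow>bs. theta_scaled b \<tau> z))"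
    using theta_power_as_quotient[OF f(3)] .
  have I: "set as \<subseteq> I" "set bs \<subseteq> I" "1 \<in> I"
    using q sign_group_pos[OF assms] by auto
  have *: "f = mero_rep (\<lambda>\<tau> z. \<epsilon> * dedekind_eta \<tau> powi n
      * ((\<Prod>a\<leftarrow>as. theta_scaled a \<tau> z) / (\<Prod>b\<leftarrow>bs. theta_scaled b \<tau> z)))"
    unfolding f(1) theta_monomial_def by (intro mero_rep_cong mero_eq_mult mero_eq_refl q(3))
  show "f \<in> theta_quotients I"
  proof (cases "\<epsilon> = 1")
    case True
    then have "f = mero_rep (\<lambda>\<tau> z. dedekind_eta \<tau> powi n
      * (\<Prod>a\<leftarrow>as. theta_scaled a \<tau> z) / (\<Prod>b\<leftarrow>bs. theta_scaled b \<tau> z))"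
      using * by simp
    then show ?thesis
      unfolding theta_quotients_def using I by blast
  next
    case False
    then have \<epsilon>: "\<epsilon> = - 1" "- 1 \<in> I"
      using sign_group_minus_one[OF assms f(2)] by auto
    \<comment> \<open>By oddness the constant -1 is a theta quotient, with index -1 in the numerator
      and 1 in the denominator.\<close>
    have "mero_eq (\<lambda>\<tau> z. \<epsilon>) (\<lambda>\<tau> z. theta_scaled (- 1) \<tau> z / theta_scaled 1 \<tau> z)"
      unfolding mero_eq_def
    proof (intro ballI allI)
      fix \<tau> z assume "\<tau> \<in> upper_half_plane"
      then have "\<forall>\<^sub>F w in at z. theta_scaled 1 \<tau> w \<noteq> 0"
        by (intro eventually_theta_scaled_nonzero) auto
      then show "\<forall>\<^sub>F w in at z. \<epsilon> = theta_scaled (- 1) \<tau> w / theta_scaled 1 \<tau> w"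
        by eventually_elim (simp add: theta_scaled_uminus \<epsilon>)
    qed
    then have "f = mero_rep (\<lambda>\<tau> z. (theta_scaled (- 1) \<tau> z / theta_scaled 1 \<tau> z) * dedekind_eta \<tau> powi n
      * ((\<Prod>a\<leftarrow>as. theta_scaled a \<tau> z) / (\<Prod>b\<leftarrow>bs. theta_scaled b \<tau> z)))"
      unfolding * by (intro mero_rep_cong mero_eq_mult mero_eq_refl)
    also have "\<dots> = mero_rep (\<lambda>\<tau> z. dedekind_eta \<tau> powi n
      * (\<Prod>a\<leftarrow>(- 1) # as. theta_scaled a \<tau> z) / (\<Prod>b\<leftarrow>1 # bs. theta_scaled b \<tau> z))"
      by (simp add: mult_ac)
    finally have "f = mero_rep (\<lambda>\<tau> z. dedekind_eta \<tau> powi n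
      * (\<Prod>a\<leftarrow>(- 1) # as. theta_scaled a \<tau> z) / (\<Prod>b\<leftarrow>1 # bs. theta_scaled b \<tau> z))" .
    moreover have "set ((- 1) # as) \<subseteq> I" "set (1 # bs) \<subseteq> I"
      using I \<epsilon>(2) by auto
    ultimately show ?thesis
      unfolding theta_quotients_def by blast
  qed
qed

section \<open>Group structure on normal forms\<close>

lemma theta_quotient_group_simps [simp]:
  "carrier (theta_quotient_group I) = theta_quotients I"
  "f \<otimes>\<^bsub>theta_quotient_group I\<^esub> g = mero_rep (\<lambda>\<tau> z. f \<tau> z * g \<tau> z)"
  "\<one>\<^bsub>theta_quotient_group I\<^esub> = theta_monomial 1 0 0"
  by (simp_all add: theta_quotient_group_def theta_monomial_def)

lemma theta_quotientE:
  assumes "sign_group I E" "f \<in> theta_quotients I"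
  obtains \<epsilon> n m where "f = theta_monomial \<epsilon> n m" "\<epsilon> \<in> E" "Poly_Mapping.keys m \<subseteq> {0<..}"
  using assms(2) unfolding theta_quotients_eq[OF assms(1)] by blast

lemma theta_monomial_in_theta_quotients:
  assumes "sign_group I E" "\<epsilon> \<in> E" "Poly_Mapping.keys m \<subseteq> {0<..}"
  shows "theta_monomial \<epsilon> n m \<in> theta_quotients I"
  using assms(2,3) unfolding theta_quotients_eq[OF assms(1)] by blast

lemma group_theta_quotient_group:
  assumes "sign_group I E"
  shows "group (theta_quotient_group I)"
proof (rule groupI)
  note I = theta_monomial_in_theta_quotients[OF assms]
  show "f \<otimes>\<^bsub>theta_quotient_group I\<^esub> g \<in> carrier (theta_quotient_group I)"
    if fg: "f \<in> carrier (theta_quotient_group I)" "g \<in> carrier (theta_quotient_group I)" for f g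
  proof -
    obtain \<epsilon> n m where f: "f = theta_monomial \<epsilon> n m" "\<epsilon> \<in> E" "Poly_Mapping.keys m \<subseteq> {0<..}"
      using fg(1) by (auto simp: theta_quotients_eq[OF assms])
    obtain \<delta> n' m' where g: "g = theta_monomial \<delta> n' m'" "\<delta> \<in> E" "Poly_Mapping.keys m' \<subseteq> {0<..}"
      using fg(2) by (auto simp: theta_quotients_eq[OF assms])
    show ?thesis
      using f g by (simp add: theta_monomial_mult I sign_group_mult[OF assms] keys_add_subset)
  qed
  show "\<one>\<^bsub>theta_quotient_group I\<^esub> \<in> carrier (theta_quotient_group I)"
    by (auto intro!: I sign_group_one[OF assms])
  show "f \<otimes>\<^bsub>theta_quotient_group I\<^esub> g \<otimes>\<^bsub>theta_quotient_group I\<^esub> h =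
      f \<otimes>\<^bsub>theta_quotient_group I\<^esub> (g \<otimes>\<^bsub>theta_quotient_group I\<^esub> h)"
    if "f \<in> carrier (theta_quotient_group I)" "g \<in> carrier (theta_quotient_group I)"
      "h \<in> carrier (theta_quotient_group I)" for f g h
    using that by (auto simp: theta_quotients_eq[OF assms] theta_monomial_mult keys_add_subset
        add.assoc mult.assoc)
  show "\<one>\<^bsub>theta_quotient_group I\<^esub> \<otimes>\<^bsub>theta_quotient_group I\<^esub> f = f"
    if "f \<in> carrier (theta_quotient_group I)" for f
    using that by (auto simp: theta_quotients_eq[OF assms] theta_monomial_mult)
  show "\<exists>g\<in>carrier (theta_quotient_group I). g \<otimes>\<^bsub>theta_quotient_group I\<^esub> f = \<one>\<^bsub>theta_quotient_group I\<^esub>"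
    if f: "f \<in> carrier (theta_quotient_group I)" for f
  proof -
    obtain \<epsilon> n m where f: "f = theta_monomial \<epsilon> n m" "\<epsilon> \<in> E" "Poly_Mapping.keys m \<subseteq> {0<..}"
      using f by (auto simp: theta_quotients_eq[OF assms])
    \<comment> \<open>The inverse negates both exponents and keeps the sign, which is its own
      inverse.\<close>
    then have "mero_rep (\<lambda>\<tau> z. theta_monomial \<epsilon> (- n) (- m) \<tau> z * f \<tau> z) = theta_monomial 1 0 0"
      by (simp add: theta_monomial_mult sign_group_square[OF assms])
    then show ?thesis
      using f by (auto intro!: bexI[of _ "theta_monomial \<epsilon> (- n) (- m)"] I)
  qed
qed

section \<open>The divisor homomorphism, its section and its kernel\<close>

lemma Div_hom:
  assumes "sign_group I E"
  shows "Div \<in> hom (theta_quotient_group I) (free_Abelian_group {0<..})"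
proof (rule homI)
  note nz = sign_group_nonzero[OF assms]
  show "Div f \<in> carrier (free_Abelian_group {0<..})" if f: "f \<in> carrier (theta_quotient_group I)" for f
  proof -
    obtain \<epsilon> n m where *: "f = theta_monomial \<epsilon> n m" "\<epsilon> \<in> E" "Poly_Mapping.keys m \<subseteq> {0<..}"
      using f by (auto simp: theta_quotients_eq[OF assms])
    then show ?thesis
      by (simp add: Div_theta_monomial nz keys_theta_divisor)
  qed
  show "Div (f \<otimes>\<^bsub>theta_quotient_group I\<^esub> g) = Div f \<otimes>\<^bsub>free_Abelian_group {0<..}\<^esub> Div g"
    if fg: "f \<in> carrier (theta_quotient_group I)" "g \<in> carrier (theta_quotient_group I)" for f g
  proof -
    obtain \<epsilon> n m where f: "f = theta_monomial \<epsilon> n m" "\<epsilon> \<in> E" "Poly_Mapping.keys m \<subseteq> {0<..}"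
      using fg(1) by (auto simp: theta_quotients_eq[OF assms])
    obtain \<delta> n' m' where g: "g = theta_monomial \<delta> n' m'" "\<delta> \<in> E" "Poly_Mapping.keys m' \<subseteq> {0<..}"
      using fg(2) by (auto simp: theta_quotients_eq[OF assms])
    have "\<epsilon> \<noteq> 0" "\<delta> \<noteq> 0"
      using nz f g by auto
    with f g show ?thesis
      by (simp add: theta_monomial_mult Div_theta_monomial keys_add_subset theta_divisor_def frag_extend_add)
  qed
qed

text \<open>On exponent vectors the section is the linear map \<open>S_exponents\<close>, a right
  inverse of \<open>theta_divisor\<close> by Moebius inversion.\<close>

lemma splits_via_S_Div:
  assumes "sign_group I E"
  shows "splits_via (theta_quotient_group I) (free_Abelian_group {0<..}) Div S_Div"
  unfolding splits_via_def
proof (intro conjI ballI homI)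
  note one = sign_group_one[OF assms]
  fix D :: "nat \<Rightarrow>\<^sub>0 int" assume D: "D \<in> carrier (free_Abelian_group {0<..})"
  then show "S_Div D \<in> carrier (theta_quotient_group I)"
    by (simp add: S_Div_eq_theta_monomial keys_S_exponents theta_monomial_in_theta_quotients[OF assms one])
  show "Div (S_Div D) = D"
    using D by (simp add: S_Div_eq_theta_monomial Div_theta_monomial keys_S_exponents theta_divisor_S_exponents)
  fix D' :: "nat \<Rightarrow>\<^sub>0 int" assume D': "D' \<in> carrier (free_Abelian_group {0<..})"
  have "S_exponents (D + D') = S_exponents D + S_exponents D'"
    by (simp add: S_exponents_def frag_extend_add)
  then show "S_Div (D \<otimes>\<^bsub>free_Abelian_group {0<..}\<^esub> D') = S_Div D \<otimes>\<^bsub>theta_quotient_group I\<^esub> S_Div D'"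
    using D D' by (simp add: S_Div_eq_theta_monomial theta_monomial_mult keys_S_exponents keys_add_subset)
qed

text \<open>\<open>S_exponents\<close> is also a left inverse of \<open>theta_divisor\<close>, so a
  trivial divisor forces m = 0 and only \<epsilon> \<eta>^n remains.\<close>

lemma kernel_Div:
  assumes "sign_group I E"
  shows "kernel (theta_quotient_group I) (free_Abelian_group {0<..}) Div =
    {mero_rep (\<lambda>\<tau> z. \<epsilon> * dedekind_eta \<tau> powi n) | \<epsilon> n. \<epsilon> \<in> E}"
proof -
  have 0: "theta_divisor 0 = 0" "S_exponents 0 = 0"
    by (simp_all add: theta_divisor_def S_exponents_def)
  have m: "m = 0" if "theta_divisor m = 0" "Poly_Mapping.keys m \<subseteq> {0<..}" for m
    using S_exponents_theta_divisor[OF that(2)] that(1) 0 by simp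
  have "kernel (theta_quotient_group I) (free_Abelian_group {0<..}) Div = {theta_monomial \<epsilon> n 0 | \<epsilon> n. \<epsilon> \<in> E}"
  proof (intro equalityI subsetI)
    fix f assume "f \<in> kernel (theta_quotient_group I) (free_Abelian_group {0<..}) Div"
    then have f: "f \<in> theta_quotients I" "Div f = 0"
      by (auto simp: kernel_def)
    obtain \<epsilon> n m where *: "f = theta_monomial \<epsilon> n m" "\<epsilon> \<in> E" "Poly_Mapping.keys m \<subseteq> {0<..}"
      using theta_quotientE[OF assms f(1)] .
    then have "theta_divisor m = 0"
      using f(2) sign_group_nonzero[OF assms *(2)] by (simp add: Div_theta_monomial)
    then have "m = 0"
      using m *(3) by blast
    with * show "f \<in> {theta_monomial \<epsilon> n 0 | \<epsilon> n. \<epsilon> \<in> E}"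
      by blast
  next
    fix f assume "f \<in> {theta_monomial \<epsilon> n 0 | \<epsilon> n. \<epsilon> \<in> E}"
    then obtain \<epsilon> n where "f = theta_monomial \<epsilon> n 0" "\<epsilon> \<in> E"
      by blast
    then show "f \<in> kernel (theta_quotient_group I) (free_Abelian_group {0<..}) Div"
      using sign_group_nonzero[OF assms]
      by (auto simp: kernel_def Div_theta_monomial 0 intro!: theta_monomial_in_theta_quotients[OF assms])
  qed
  then show ?thesis
    by (simp add: theta_monomial_def)
qed

lemma short_exact_Div:
  assumes "sign_group I E"
    and K: "K = {mero_rep (\<lambda>\<tau> z. \<epsilon> * dedekind_eta \<tau> powi n) | \<epsilon> n. \<epsilon> \<in> E}"
  shows "short_exact (theta_quotient_group I\<lparr>carrier := K\<rparr>) (theta_quotient_group I)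
    (free_Abelian_group {0<..}) id Div"
proof -
  let ?G = "theta_quotient_group I" and ?F = "free_Abelian_group {0<..} :: (nat \<Rightarrow>\<^sub>0 int) monoid"
  have G: "group ?G"
    by (rule group_theta_quotient_group[OF assms(1)])
  have hom: "Div \<in> hom ?G ?F"
    by (rule Div_hom[OF assms(1)])
  have ker: "kernel ?G ?F Div = K"
    unfolding K by (rule kernel_Div[OF assms(1)])
  interpret group_hom ?G ?F Div
    using G hom by (simp add: group_hom_def group_hom_axioms_def)
  \<comment> \<open>Being a kernel, K is a subgroup, so the left term of the sequence is a group
    under the inherited operations.\<close>
  have K_subgroup: "subgroup K ?G"
    using subgroup_kernel unfolding ker .
  have "Div ` carrier ?G = carrier ?F"
  proof (intro equalityI subsetI)
    show "D \<in> carrier ?F" if "D \<in> Div ` carrier ?G" for D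
      using that hom_closed by auto
    \<comment> \<open>Surjectivity comes from the section.\<close>
    show "D \<in> Div ` carrier ?G" if "D \<in> carrier ?F" for D
      using splits_via_S_Div[OF assms(1)] that unfolding splits_via_def hom_def
      by (metis (mono_tags, lifting) Pi_iff image_eqI mem_Collect_eq)
  qed
  moreover have "id \<in> mon (?G\<lparr>carrier := K\<rparr>) ?G"
    using subgroup.subset[OF K_subgroup] by (auto simp: mon_def hom_def)
  moreover have "group (?G\<lparr>carrier := K\<rparr>)"
    using K_subgroup by (rule subgroup.subgroup_is_group[OF _ G])
  ultimately show ?thesis
    using G hom ker by (simp add: short_exact_def epi_def)
qed

text \<open>With positive indices the kernel is exactly the group of powers of \<eta>. With all
  nonzero indices it also contains -1, so the powers appear up to sign; the same section splits both
  sequences.\<close>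

theorem theorem3p3:
  shows "short_exact (TQ_pos\<lparr>carrier := eta_powers\<rparr>) TQ_pos (free_Abelian_group {0<..}) id Div \<and>
     splits_via TQ_pos (free_Abelian_group {0<..}) Div S_Div \<and>
     short_exact (TQ\<lparr>carrier := signed_eta_powers\<rparr>) TQ (free_Abelian_group {0<..}) id Div \<and>
     splits_via TQ (free_Abelian_group {0<..}) Div S_Div"
proof -
  have pos: "sign_group {a. a > 0} {1}" and all: "sign_group {a. a \<noteq> 0} {1, - 1}"
    by (simp_all add: sign_group_def)
  have "eta_powers = {mero_rep (\<lambda>\<tau> z. \<epsilon> * dedekind_eta \<tau> powi n) | \<epsilon> n. \<epsilon> \<in> {1}}"
    by (simp add: eta_powers_def)
  then show ?thesis
    using short_exact_Div[OF pos] short_exact_Div[OF all signed_eta_powers_def]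
      splits_via_S_Div[OF pos] splits_via_S_Div[OF all]
    unfolding TQ_def TQ_pos_def by blast
qed

end
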